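(* Let $L_f\geq \mu_f>0$ with $\kappa_f=L_f/\mu_f\ge2$, let $\kappa_A\ge1$, $D>0$ and $0<\epsilon\le\frac D{20}$. For any first-order linear span algorithm (class $\mathcal A$), there exists a problem instance in $\mathcal F_{\mathrm{SC}}(L_f,\mu_f,\kappa_A,D)$ such that at least $$\Omega\left(\kappa_A\sqrt{\kappa_f}\log\left(\frac D\epsilon\right)\right)$$ iterations are required in order to find an iterate $x_k$ satisfying $\|x_k-x^\star\|\le\epsilon$.
   Context: $\Omega(\cdot)$ hides a universal positive constant, independent of all parameters. Class $\mathcal F_{\mathrm{SC}}(L_f,\mu_f,\kappa_A,D)$: problems $\min_xf(x)+h(Ax-b)$ ($h$ proper closed convex; linear equality constraints $Ax=b$ correspond to $h=\mathbb I_{\{0\}}$, the indicator function of $\{0\}$) of arbitrary dimension, with $f$ $L_f$-smooth and $\mu_f$-strongly convex, $\|x_0-x^\star\|\le D$ where $x^\star$ is the optimal solution, and condition number of $A$ (norm over minimal singular value) at most $\kappa_A$. First-order linear span algorithm (class $\mathcal A$): with $x_0=0,\lambda_0=0$, $\mathcal S_0^x=\mathrm{Span}\{x_0\}$, $\mathcal S_0^\lambda=\mathrm{Span}\{\lambda_0\}$, the iterates satisfy $(x_k,\lambda_k)\in\mathcal S^x_k\times\mathcal S^\lambda_k$, where $$\mathcal S^x_{k+1}=\mathrm{Span}\{x_i,\nabla f(\hat x_i),A^{\mathrm T}\hat\lambda_i:\ \hat x_i\in\mathcal S^x_i,\hat\lambda_i\in\mathcal S^\lambda_i,0\le i\le k\},$$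 $$\mathcal S^\lambda_{k+1}=\mathrm{Span}\{\lambda_i,\mathrm{prox}_{\eta_ih^\star}(\hat\lambda_i+\eta_i(A\hat x_i-b)):\ \hat x_i\in\mathcal S^x_i,\hat\lambda_i\in\mathcal S^\lambda_i,0\le i\le k\},$$ with step sizes $\eta_i>0$ and $h^\star$ the convex conjugate. For linear equality constrained problems ($\min f(x)$ s.t. $Ax=b$) the class is taken to be: $x_{k+1}\in\mathcal S^x_{k+1}=\mathrm{Span}\{x_i,\nabla f(\hat x_i),A^{\mathrm T}(A\hat x_i-b):\hat x_i\in\mathcal S_i^x,0\le i\le k\}$. *)

theory Defs
  imports
    "Jordan_Normal_Form.Spectral_Radius"
    "Jordan_Normal_Form.VS_Connect"
    "HOL-Library.Extended_Real"
begin

text \<open>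
  The dimension of a problem is part of the instance, so \<open>\<real>\<^sup>n\<close> is rendered as
  \<open>carrier_vec n :: real vec set\<close>. Functions on \<open>\<real>\<^sup>n\<close> are total functions on \<open>real vec\<close>;
  all definitions below only inspect their values on the carrier.
\<close>

definition vnorm :: "real vec \<Rightarrow> real" where
  "vnorm v = sqrt (scalar_prod v v)"

abbreviation vspan :: "nat \<Rightarrow> real vec set \<Rightarrow> real vec set" where
  "vspan n \<equiv> LinearCombinations.module.span class_ring (module_vec TYPE(real) n)"

subsection \<open>Smooth and strongly convex functions\<close>

definition has_gradient ::
    "nat \<Rightarrow> (real vec \<Rightarrow> real) \<Rightarrow> real vec \<Rightarrow> real vec \<Rightarrow> bool" where
  "has_gradient n f x g \<longleftrightarrow> g \<in> carrier_vec n \<and>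
     (\<forall>e>0. \<exists>d>0. \<forall>y\<in>carrier_vec n. vnorm (y - x) < d \<longrightarrow>
        \<bar>f y - f x - scalar_prod g (y - x)\<bar> \<le> e * vnorm (y - x))"

definition grad :: "nat \<Rightarrow> (real vec \<Rightarrow> real) \<Rightarrow> real vec \<Rightarrow> real vec" where
  "grad n f x = (THE g. has_gradient n f x g)"

definition smooth_fun :: "nat \<Rightarrow> real \<Rightarrow> (real vec \<Rightarrow> real) \<Rightarrow> bool" where
  "smooth_fun n L f \<longleftrightarrow>
     (\<forall>x\<in>carrier_vec n. \<exists>g. has_gradient n f x g) \<and>
     (\<forall>x\<in>carrier_vec n. \<forall>y\<in>carrier_vec n.
        vnorm (grad n f x - grad n f y) \<le> L * vnorm (x - y))"

definition strongly_convex_fun :: "nat \<Rightarrow> real \<Rightarrow> (real vec \<Rightarrow> real) \<Rightarrow> bool" where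
  "strongly_convex_fun n \<mu> f \<longleftrightarrow>
     (\<forall>x\<in>carrier_vec n. \<forall>y\<in>carrier_vec n. \<forall>t. 0 \<le> t \<and> t \<le> 1 \<longrightarrow>
        f (t \<cdot>\<^sub>v x + (1 - t) \<cdot>\<^sub>v y)
          \<le> t * f x + (1 - t) * f y - \<mu> / 2 * t * (1 - t) * (vnorm (x - y))^2)"

subsection \<open>Extended-valued convex functions, conjugate and proximal operator\<close>

definition proper_fun :: "nat \<Rightarrow> (real vec \<Rightarrow> ereal) \<Rightarrow> bool" where
  "proper_fun m h \<longleftrightarrow>
     (\<forall>u\<in>carrier_vec m. h u \<noteq> -\<infinity>) \<and> (\<exists>u\<in>carrier_vec m. h u \<noteq> \<infinity>)"

definition convex_fun :: "nat \<Rightarrow> (real vec \<Rightarrow> ereal) \<Rightarrow> bool" where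
  "convex_fun m h \<longleftrightarrow>
     (\<forall>u\<in>carrier_vec m. \<forall>v\<in>carrier_vec m. \<forall>t. 0 \<le> t \<and> t \<le> 1 \<longrightarrow>
        h (t \<cdot>\<^sub>v u + (1 - t) \<cdot>\<^sub>v v) \<le> ereal t * h u + ereal (1 - t) * h v)"

text \<open>Closedness: the epigraph is (sequentially) closed in \<open>\<real>\<^sup>m \<times> \<real>\<close>.\<close>

definition closed_fun :: "nat \<Rightarrow> (real vec \<Rightarrow> ereal) \<Rightarrow> bool" where
  "closed_fun m h \<longleftrightarrow>
     (\<forall>(U :: nat \<Rightarrow> real vec) (r :: nat \<Rightarrow> real) u s.
        (\<forall>i. U i \<in> carrier_vec m \<and> h (U i) \<le> ereal (r i)) \<and> u \<in> carrier_vec m \<and>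
        (\<lambda>i. vnorm (U i - u)) \<longlonglongrightarrow> 0 \<and> r \<longlonglongrightarrow> s
        \<longrightarrow> h u \<le> ereal s)"

definition conjugate_fun :: "nat \<Rightarrow> (real vec \<Rightarrow> ereal) \<Rightarrow> real vec \<Rightarrow> ereal" where
  "conjugate_fun m h v = (SUP u\<in>carrier_vec m. ereal (scalar_prod v u) - h u)"

text \<open>\<open>prox m \<eta> g\<close> is the proximal operator of \<open>\<eta> g\<close>.\<close>

definition prox :: "nat \<Rightarrow> real \<Rightarrow> (real vec \<Rightarrow> ereal) \<Rightarrow> real vec \<Rightarrow> real vec" where
  "prox m \<eta> g v = (THE u. is_arg_min
     (\<lambda>u. ereal \<eta> * g u + ereal ((vnorm (u - v))^2 / 2)) (\<lambda>u. u \<in> carrier_vec m) u)"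

subsection \<open>Condition number\<close>

definition op_norm :: "real mat \<Rightarrow> real" where
  "op_norm A = Sup {vnorm (A *\<^sub>v v) | v. v \<in> carrier_vec (dim_col A) \<and> vnorm v \<le> 1}"

text \<open>
  An \<open>m \<times> n\<close> matrix has \<open>min m n\<close> singular values, the square roots of the eigenvalues of
  the smaller of the two Gram matrices. The minimal one is positive iff the matrix has full rank.
\<close>

definition singular_values :: "real mat \<Rightarrow> real set" where
  "singular_values A = sqrt ` spectrum
     (if dim_row A \<le> dim_col A then A * transpose_mat A else transpose_mat A * A)"

definition min_singular_value :: "real mat \<Rightarrow> real" where
  "min_singular_value A = Min (singular_values A)"

definition cond_number :: "real mat \<Rightarrow> real" where
  "cond_number A = op_norm A / min_singular_value A"

subsection \<open>Problem instances\<close>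

text \<open>The instance \<open>min\<^sub>x f x + h (A x - b)\<close>, with \<open>x \<in> \<real>\<^sup>n\<close> for \<open>n = dim_col A\<close>.\<close>

record problem =
  obj :: "real vec \<Rightarrow> real"
  reg :: "real vec \<Rightarrow> ereal"
  cmat :: "real mat"
  rhs :: "real vec"

abbreviation xdim :: "problem \<Rightarrow> nat" where
  "xdim P \<equiv> dim_col (cmat P)"

abbreviation ldim :: "problem \<Rightarrow> nat" where
  "ldim P \<equiv> dim_row (cmat P)"

definition objective :: "problem \<Rightarrow> real vec \<Rightarrow> ereal" where
  "objective P x = ereal (obj P x) + reg P (cmat P *\<^sub>v x - rhs P)"

definition optimal_solution :: "problem \<Rightarrow> real vec \<Rightarrow> bool" where
  "optimal_solution P x \<longleftrightarrow>
     is_arg_min (objective P) (\<lambda>y. y \<in> carrier_vec (xdim P)) x \<and> objective P x \<noteq> \<infinity>"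

text \<open>\<open>h\<close> is the indicator function of \<open>{0}\<close>, so that the problem is \<open>min f x\<close> s.t. \<open>A x = b\<close>.\<close>

definition equality_constrained :: "problem \<Rightarrow> bool" where
  "equality_constrained P \<longleftrightarrow>
     (\<forall>u\<in>carrier_vec (ldim P). reg P u = (if u = 0\<^sub>v (ldim P) then 0 else \<infinity>))"

text \<open>The starting point is \<open>x\<^sub>0 = 0\<close>.\<close>

definition F_SC :: "real \<Rightarrow> real \<Rightarrow> real \<Rightarrow> real \<Rightarrow> problem set" where
  "F_SC Lf \<mu>f \<kappa>A D = {P.
     0 < xdim P \<and> 0 < ldim P \<and> rhs P \<in> carrier_vec (ldim P) \<and>
     smooth_fun (xdim P) Lf (obj P) \<and> strongly_convex_fun (xdim P) \<mu>f (obj P) \<and>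
     proper_fun (ldim P) (reg P) \<and> convex_fun (ldim P) (reg P) \<and> closed_fun (ldim P) (reg P) \<and>
     min_singular_value (cmat P) > 0 \<and> cond_number (cmat P) \<le> \<kappa>A \<and>
     (\<exists>xs. optimal_solution P xs \<and> vnorm (0\<^sub>v (xdim P) - xs) \<le> D)}"

subsection \<open>First-order linear span algorithms\<close>

definition primal_dual_span_run ::
    "problem \<Rightarrow> (nat \<Rightarrow> real vec) \<Rightarrow> (nat \<Rightarrow> real vec) \<Rightarrow> bool" where
  "primal_dual_span_run P x l \<longleftrightarrow>
     x 0 = 0\<^sub>v (xdim P) \<and> l 0 = 0\<^sub>v (ldim P) \<and>
     (\<exists>(\<eta> :: nat \<Rightarrow> real) (Sx :: nat \<Rightarrow> real vec set) (Sl :: nat \<Rightarrow> real vec set).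
        (\<forall>i. \<eta> i > 0) \<and>
        Sx 0 = vspan (xdim P) {x 0} \<and> Sl 0 = vspan (ldim P) {l 0} \<and>
        (\<forall>k. Sx (Suc k) = vspan (xdim P)
               ({x i | i. i \<le> k} \<union>
                {grad (xdim P) (obj P) xh | xh i. i \<le> k \<and> xh \<in> Sx i} \<union>
                {transpose_mat (cmat P) *\<^sub>v lh | lh i. i \<le> k \<and> lh \<in> Sl i})) \<and>
        (\<forall>k. Sl (Suc k) = vspan (ldim P)
               ({l i | i. i \<le> k} \<union>
                {prox (ldim P) (\<eta> i) (conjugate_fun (ldim P) (reg P))
                   (lh + \<eta> i \<cdot>\<^sub>v (cmat P *\<^sub>v xh - rhs P))
                 | xh lh i. i \<le> k \<and> xh \<in> Sx i \<and> lh \<in> Sl i})) \<and>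
        (\<forall>k. x k \<in> Sx k \<and> l k \<in> Sl k))"

definition equality_span_run :: "problem \<Rightarrow> (nat \<Rightarrow> real vec) \<Rightarrow> bool" where
  "equality_span_run P x \<longleftrightarrow>
     x 0 = 0\<^sub>v (xdim P) \<and>
     (\<exists>Sx :: nat \<Rightarrow> real vec set.
        Sx 0 = vspan (xdim P) {x 0} \<and>
        (\<forall>k. Sx (Suc k) = vspan (xdim P)
               ({x i | i. i \<le> k} \<union>
                {grad (xdim P) (obj P) xh | xh i. i \<le> k \<and> xh \<in> Sx i} \<union>
                {transpose_mat (cmat P) *\<^sub>v (cmat P *\<^sub>v xh - rhs P)
                 | xh i. i \<le> k \<and> xh \<in> Sx i})) \<and>
        (\<forall>k. x k \<in> Sx k))"

text \<open>
  An algorithm maps a problem instance to its sequence of iterates \<open>(x\<^sub>k, \<lambda>\<^sub>k)\<close>. It is only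
  required to follow the span rules on the problems of the given class \<open>F\<close>. On equality
  constrained problems either span rule is admitted; under the second one the dual
  iterates are irrelevant.
\<close>

definition span_algorithm ::
    "problem set \<Rightarrow> (problem \<Rightarrow> nat \<Rightarrow> real vec \<times> real vec) \<Rightarrow> bool" where
  "span_algorithm F alg \<longleftrightarrow>
     (\<forall>P\<in>F. primal_dual_span_run P (\<lambda>k. fst (alg P k)) (\<lambda>k. snd (alg P k)) \<or>
        (equality_constrained P \<and> equality_span_run P (\<lambda>k. fst (alg P k))))"

end

theory Submission
  imports Defs "HOL-Analysis.L2_Norm"
begin

text \<open>
  The hard instance is one long chain of coordinates, cut into blocks of \<open>m \<approx> \<kappa>\<^sub>A\<close> consecutive ones.
  Inside a block, neighbours are tied together by the constraints \<open>A x = 0\<close>; the end of a block and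
  the start of the next one are tied together by the quadratic objective. A gradient step or an
  application of \<open>A\<^sup>T A\<close> advances by at most one coordinate along the chain, so \<open>k\<close> iterations see
  only \<open>k / m\<close> blocks. On the feasible set the problem reduces to a tridiagonal quadratic with
  condition number of order \<open>\<kappa>\<^sub>f\<close>, whose solution decays from block to block by a factor \<open>q\<close> with
  \<open>ln (1 / q) = O(1 / sqrt \<kappa>\<^sub>f)\<close>. Hence the error after \<open>k\<close> iterations is at least of order
  \<open>D q^(k / m)\<close>.
\<close>

subsection \<open>Euclidean norm, spans and gradients\<close>

text \<open>The factor \<open>\<kappa>A\<close> comes from the difference operator along a path: on
  \<open>m\<close> vertices its condition number is at most of order \<open>m\<close>, so blocks of
  length about \<open>\<kappa>A / 3\<close> are affordable. The general estimate
  \<open>2 * sqrt 2 * m\<close> says nothing for \<open>\<kappa>A\<close> near 1; there blocks of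
  length two are taken, whose constraint rows are orthonormal. With block values \<open>y_j\<close>,
  stationarity on the kernel of \<open>A\<close> reads
  \<open>K (2 y_j - y_(j-1) - y_(j+1)) + \<mu> (2 + e r^2) y_j = 0\<close>. Its characteristic
  equation is the locale assumption \<open>recurrence\<close>, and \<open>q\<close> is the decaying
  root. The chain has to be finite, so both ends are modified to keep \<open>q^j\<close> an exact
  solution, and the number \<open>d\<close> of blocks is taken so large that the cut-off tail costs
  at most half of the squared error. Thus \<open>d\<close> depends on the accuracy, but not on the
  algorithm. The bound 20 on \<open>D / \<epsilon>\<close> absorbs the constant factor 6 lost in the
  squared error.\<close>

lemma scalar_prod_self_sum: "v \<bullet> v = (\<Sum>i<dim_vec v. (v $ i)\<^sup>2)" for v :: "real vec"
  unfolding scalar_prod_def by (simp add: lessThan_atLeast0 power2_eq_square)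

lemma scalar_prod_self_nonneg: "0 \<le> v \<bullet> v" for v :: "real vec"
  unfolding scalar_prod_self_sum by (simp add: sum_nonneg)

lemma vnorm_squared: "(vnorm v)\<^sup>2 = v \<bullet> v"
  unfolding vnorm_def by (simp add: scalar_prod_self_nonneg)

lemma vnorm_nonneg: "0 \<le> vnorm v"
  unfolding vnorm_def by (simp add: scalar_prod_self_nonneg)

lemma vnorm_squared_sum: "(vnorm v)\<^sup>2 = (\<Sum>i<dim_vec v. (v $ i)\<^sup>2)"
  by (simp add: vnorm_squared scalar_prod_self_sum)

lemma vnorm_eq_0_iff: "vnorm v = 0 \<longleftrightarrow> v = 0\<^sub>v (dim_vec v)"
proof
  assume "vnorm v = 0"
  then have "(\<Sum>i<dim_vec v. (v $ i)\<^sup>2) = 0"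
    using vnorm_squared_sum[of v] by simp
  then show "v = 0\<^sub>v (dim_vec v)"
    by (intro eq_vecI) (auto simp: sum_nonneg_eq_0_iff)
next
  assume "v = 0\<^sub>v (dim_vec v)"
  then have "\<And>i. i < dim_vec v \<Longrightarrow> v $ i = 0"
    by (metis index_zero_vec(1))
  then show "vnorm v = 0"
    unfolding vnorm_def scalar_prod_self_sum by simp
qed

lemma vnorm_smult: "vnorm (c \<cdot>\<^sub>v v) = \<bar>c\<bar> * vnorm v"
proof -
  have "(c \<cdot>\<^sub>v v) \<bullet> (c \<cdot>\<^sub>v v) = c\<^sup>2 * (v \<bullet> v)"
    by (simp add: scalar_prod_self_sum power_mult_distrib sum_distrib_left)
  then show ?thesis
    unfolding vnorm_def by (simp add: real_sqrt_mult)
qed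

lemma vnorm_minus_commute:
  assumes "u \<in> carrier_vec n" "v \<in> carrier_vec n"
  shows "vnorm (u - v) = vnorm (v - u)"
proof -
  have "u - v = (-1) \<cdot>\<^sub>v (v - u)"
    using assms by (intro eq_vecI) auto
  then show ?thesis by (simp add: vnorm_smult)
qed

lemma vnorm_L2_set: "vnorm v = L2_set (($) v) {..<dim_vec v}"
  unfolding vnorm_def L2_set_def scalar_prod_self_sum ..

lemma scalar_prod_le_vnorm:
  assumes "u \<in> carrier_vec n" "v \<in> carrier_vec n"
  shows "\<bar>u \<bullet> v\<bar> \<le> vnorm u * vnorm v"
proof -
  have "\<bar>u \<bullet> v\<bar> \<le> (\<Sum>i<n. \<bar>u $ i\<bar> * \<bar>v $ i\<bar>)"
    using assms by (simp add: scalar_prod_def lessThan_atLeast0 flip: abs_mult)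
  also have "\<dots> \<le> vnorm u * vnorm v"
    using L2_set_mult_ineq[of "($) u" "($) v" "{..<n}"] assms by (simp add: vnorm_L2_set)
  finally show ?thesis .
qed

lemma vspan_subset:
  assumes "S \<subseteq> W" "W \<subseteq> carrier_vec n" "0\<^sub>v n \<in> W"
    and "\<And>u v. u \<in> W \<Longrightarrow> v \<in> W \<Longrightarrow> u + v \<in> W"
    and "\<And>c v. v \<in> W \<Longrightarrow> c \<cdot>\<^sub>v v \<in> W"
  shows "vspan n S \<subseteq> W"
proof -
  interpret vec_space "TYPE(real)" n .
  have "submodule class_ring W V"
    by (unfold_locales) (use assms in \<open>auto simp: module_vec_simps\<close>)
  then show ?thesis
    by (rule span_is_subset[OF assms(1)])
qed

text \<open>\<open>grad\<close> is a definite description, so no gradient can be computed before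
  uniqueness is known. Two candidates are compared along the direction of their difference.\<close>

lemma has_gradient_unique:
  assumes g: "has_gradient n f x g" and g': "has_gradient n f x g'" and x: "x \<in> carrier_vec n"
  shows "g = g'"
proof (rule ccontr)
  assume "g \<noteq> g'"
  define u where "u = g - g'"
  have gc: "g \<in> carrier_vec n" "g' \<in> carrier_vec n"
    using g g' by (auto simp: has_gradient_def)
  then have uc: "u \<in> carrier_vec n" by (simp add: u_def)
  have "vnorm u \<noteq> 0"
  proof
    assume "vnorm u = 0"
    then have "u = 0\<^sub>v n" using uc vnorm_eq_0_iff[of u] by simp
    then have "\<And>i. i < n \<Longrightarrow> g $ i = g' $ i"
      using gc u_def by (metis carrier_vecD eq_iff_diff_eq_0 index_minus_vec(1) index_zero_vec(1))
    then show False using gc \<open>g \<noteq> g'\<close> by (metis carrier_vecD eq_vecI)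
  qed
  then have u: "0 < vnorm u" using vnorm_nonneg[of u] by simp
  \<comment> \<open>Each candidate errs by at most \<open>e\<close> per unit length, so the two
    linear forms differ by at most half of \<open>vnorm u\<close> per unit length, whereas along
    \<open>u\<close> they differ by all of \<open>vnorm u\<close>.\<close>
  define e where "e = vnorm u / 4"
  have e: "0 < e" using u by (simp add: e_def)
  obtain d1 where d1: "0 < d1" "\<And>y. y \<in> carrier_vec n \<Longrightarrow> vnorm (y - x) < d1 \<Longrightarrow>
      \<bar>f y - f x - g \<bullet> (y - x)\<bar> \<le> e * vnorm (y - x)"
    using g e unfolding has_gradient_def by blast
  obtain d2 where d2: "0 < d2" "\<And>y. y \<in> carrier_vec n \<Longrightarrow> vnorm (y - x) < d2 \<Longrightarrow>
      \<bar>f y - f x - g' \<bullet> (y - x)\<bar> \<le> e * vnorm (y - x)"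
    using g' e unfolding has_gradient_def by blast
  define t where "t = min d1 d2 / (2 * vnorm u)"
  have t: "0 < t" using d1 d2 u by (simp add: t_def)
  define y where "y = x + t \<cdot>\<^sub>v u"
  have y: "y \<in> carrier_vec n" "y - x = t \<cdot>\<^sub>v u"
    using x uc by (auto simp: y_def)
  have ny: "vnorm (y - x) = t * vnorm u" using t by (simp add: y vnorm_smult)
  have tu: "t * vnorm u = min d1 d2 / 2" using u by (simp add: t_def)
  then have "vnorm (y - x) < d1" "vnorm (y - x) < d2"
    using ny d1(1) d2(1) by linarith+
  then have "\<bar>f y - f x - g \<bullet> (y - x)\<bar> \<le> e * vnorm (y - x)"
    "\<bar>f y - f x - g' \<bullet> (y - x)\<bar> \<le> e * vnorm (y - x)"
    using d1(2) d2(2) y(1) by auto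
  then have "g \<bullet> (y - x) - g' \<bullet> (y - x) \<le> 2 * e * vnorm (y - x)" by linarith
  moreover have "g \<bullet> (y - x) - g' \<bullet> (y - x) = u \<bullet> (y - x)"
    unfolding u_def using gc x y(1) by (intro minus_scalar_prod_distrib[symmetric]) auto
  moreover have "u \<bullet> (y - x) = t * (vnorm u)\<^sup>2"
    using uc by (simp add: y vnorm_squared)
  ultimately have "t * (vnorm u)\<^sup>2 \<le> 2 * e * (t * vnorm u)" using ny by simp
  then have "t * vnorm u * vnorm u \<le> t * vnorm u * (vnorm u / 2)"
    by (simp add: e_def power2_eq_square)
  moreover have "0 < t * vnorm u" using t u by simp
  ultimately have "vnorm u \<le> vnorm u / 2" by (simp only: mult_le_cancel_left_pos)
  then show False using u by simp
qed

lemma grad_eqI: "has_gradient n f x g \<Longrightarrow> x \<in> carrier_vec n \<Longrightarrow> grad n f x = g"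
  unfolding grad_def by (blast intro: has_gradient_unique)

subsection \<open>Quadratic objectives and the indicator of the origin\<close>

definition quad_fun :: "real mat \<Rightarrow> real vec \<Rightarrow> real vec \<Rightarrow> real" where
  "quad_fun H b x = (x \<bullet> (H *\<^sub>v x)) / 2 - b \<bullet> x"

text \<open>The exact second-order Taylor expansion, from which the gradient, strong convexity and
  optimality are all read off.\<close>

lemma quad_fun_add_smult:
  assumes H: "H \<in> carrier_mat n n" and sym: "transpose_mat H = H"
    and [simp]: "b \<in> carrier_vec n" "x \<in> carrier_vec n" "z \<in> carrier_vec n"
  shows "quad_fun H b (x + c \<cdot>\<^sub>v z) =
    quad_fun H b x + c * ((H *\<^sub>v x - b) \<bullet> z) + c\<^sup>2 / 2 * (z \<bullet> (H *\<^sub>v z))"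
proof -
  have [simp]: "H *\<^sub>v x \<in> carrier_vec n" "H *\<^sub>v z \<in> carrier_vec n" "c \<cdot>\<^sub>v z \<in> carrier_vec n"
    using H by auto
  have s: "x \<bullet> (H *\<^sub>v z) = (H *\<^sub>v x) \<bullet> z"
    using transpose_vec_mult_scalar[OF H, of z x] sym by simp
  have s': "z \<bullet> (H *\<^sub>v x) = (H *\<^sub>v x) \<bullet> z"
    by (rule comm_scalar_prod[of _ n]) auto
  have "H *\<^sub>v (x + c \<cdot>\<^sub>v z) = H *\<^sub>v x + c \<cdot>\<^sub>v (H *\<^sub>v z)"
    using H by (simp add: mult_add_distrib_mat_vec mult_mat_vec)
  moreover have "(x + c \<cdot>\<^sub>v z) \<bullet> (H *\<^sub>v x + c \<cdot>\<^sub>v (H *\<^sub>v z)) =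
      x \<bullet> (H *\<^sub>v x) + 2 * c * ((H *\<^sub>v x) \<bullet> z) + c\<^sup>2 * (z \<bullet> (H *\<^sub>v z))"
    by (simp add: add_scalar_prod_distrib[of _ n] scalar_prod_add_distrib[of _ n]
      smult_scalar_prod_distrib[of _ n] scalar_prod_smult_distrib[of _ n] s s' algebra_simps
      power2_eq_square)
  moreover have "b \<bullet> (x + c \<cdot>\<^sub>v z) = b \<bullet> x + c * (b \<bullet> z)"
    by (simp add: scalar_prod_add_distrib[of _ n] scalar_prod_smult_distrib[of _ n])
  moreover have lin: "(H *\<^sub>v x - b) \<bullet> z = (H *\<^sub>v x) \<bullet> z - b \<bullet> z"
    by (simp add: minus_scalar_prod_distrib[of _ n])
  ultimately show ?thesis
    unfolding quad_fun_def lin by (simp add: algebra_simps add_divide_distrib)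
qed

lemma add_smult_minus:
  fixes x y :: "real vec"
  assumes "x \<in> carrier_vec n" "y \<in> carrier_vec n"
  shows "y = x + 1 \<cdot>\<^sub>v (y - x)"
  using assms by (intro eq_vecI) auto

lemma quadratic_form_le:
  assumes H: "H \<in> carrier_mat n n" and z: "z \<in> carrier_vec n"
    and L: "\<And>z. z \<in> carrier_vec n \<Longrightarrow> vnorm (H *\<^sub>v z) \<le> L * vnorm z"
  shows "\<bar>z \<bullet> (H *\<^sub>v z)\<bar> \<le> L * (vnorm z)\<^sup>2"
proof -
  have "\<bar>z \<bullet> (H *\<^sub>v z)\<bar> \<le> vnorm z * vnorm (H *\<^sub>v z)"
    using H z by (intro scalar_prod_le_vnorm[of _ n]) auto
  also have "\<dots> \<le> vnorm z * (L * vnorm z)"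
    using L[OF z] by (intro mult_left_mono) (auto simp: vnorm_nonneg)
  finally show ?thesis by (simp add: power2_eq_square mult_ac)
qed

lemma has_gradient_quad_fun:
  assumes H: "H \<in> carrier_mat n n" "transpose_mat H = H"
    and b: "b \<in> carrier_vec n" and x: "x \<in> carrier_vec n"
    and L: "\<And>z. z \<in> carrier_vec n \<Longrightarrow> vnorm (H *\<^sub>v z) \<le> L * vnorm z" "0 < L"
  shows "has_gradient n (quad_fun H b) x (H *\<^sub>v x - b)"
  unfolding has_gradient_def
proof (intro conjI allI impI)
  show "H *\<^sub>v x - b \<in> carrier_vec n" using H b x by simp
  fix e :: real assume e: "0 < e"
  show "\<exists>d>0. \<forall>y\<in>carrier_vec n. vnorm (y - x) < d \<longrightarrow>
    \<bar>quad_fun H b y - quad_fun H b x - (H *\<^sub>v x - b) \<bullet> (y - x)\<bar> \<le> e * vnorm (y - x)"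
  proof (intro exI[of _ "e / L"] conjI ballI impI)
    show "0 < e / L" using e L by simp
    fix y :: "real vec" assume y: "y \<in> carrier_vec n" and d: "vnorm (y - x) < e / L"
    define z where "z = y - x"
    have z: "z \<in> carrier_vec n" using x y by (simp add: z_def)
    have "y = x + 1 \<cdot>\<^sub>v z" unfolding z_def by (rule add_smult_minus[OF x y])
    then have "quad_fun H b y - quad_fun H b x - (H *\<^sub>v x - b) \<bullet> z = (z \<bullet> (H *\<^sub>v z)) / 2"
      using quad_fun_add_smult[OF H b x z, of 1] by simp
    then have "\<bar>quad_fun H b y - quad_fun H b x - (H *\<^sub>v x - b) \<bullet> z\<bar> \<le> L * (vnorm z)\<^sup>2"
      using quadratic_form_le[OF H(1) z L(1)] by simp
    also have "\<dots> = (L * vnorm z) * vnorm z" by (simp add: power2_eq_square)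
    also have "\<dots> \<le> e * vnorm z"
      using d L(2) by (intro mult_right_mono) (auto simp: vnorm_nonneg z_def field_simps)
    finally show "\<bar>quad_fun H b y - quad_fun H b x - (H *\<^sub>v x - b) \<bullet> (y - x)\<bar> \<le> e * vnorm (y - x)"
      unfolding z_def .
  qed
qed

lemma grad_quad_fun:
  assumes "H \<in> carrier_mat n n" "transpose_mat H = H" "b \<in> carrier_vec n" "x \<in> carrier_vec n"
    and "\<And>z. z \<in> carrier_vec n \<Longrightarrow> vnorm (H *\<^sub>v z) \<le> L * vnorm z" "0 < L"
  shows "grad n (quad_fun H b) x = H *\<^sub>v x - b"
  using has_gradient_quad_fun[OF assms] assms(4) by (rule grad_eqI)

lemma smooth_fun_quad_fun:
  assumes H: "H \<in> carrier_mat n n" "transpose_mat H = H" and b: "b \<in> carrier_vec n"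
    and L: "\<And>z. z \<in> carrier_vec n \<Longrightarrow> vnorm (H *\<^sub>v z) \<le> L * vnorm z" "0 < L"
  shows "smooth_fun n L (quad_fun H b)"
  unfolding smooth_fun_def
proof (intro conjI ballI)
  fix x :: "real vec" assume x: "x \<in> carrier_vec n"
  show "\<exists>g. has_gradient n (quad_fun H b) x g"
    using has_gradient_quad_fun[OF H b x L] by blast
  fix y :: "real vec" assume y: "y \<in> carrier_vec n"
  have "(H *\<^sub>v x - b) - (H *\<^sub>v y - b) = H *\<^sub>v x - H *\<^sub>v y"
    using H b x y by (intro eq_vecI) auto
  also have "\<dots> = H *\<^sub>v (x - y)"
    using H x y by (intro mult_minus_distrib_mat_vec[symmetric]) auto
  finally have "grad n (quad_fun H b) x - grad n (quad_fun H b) y = H *\<^sub>v (x - y)"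
    using grad_quad_fun[OF H b x L] grad_quad_fun[OF H b y L] by simp
  then show "vnorm (grad n (quad_fun H b) x - grad n (quad_fun H b) y) \<le> L * vnorm (x - y)"
    using L(1)[of "x - y"] x y by simp
qed

lemma strongly_convex_fun_quad_fun:
  assumes H: "H \<in> carrier_mat n n" "transpose_mat H = H" and b: "b \<in> carrier_vec n"
    and mu: "\<And>z. z \<in> carrier_vec n \<Longrightarrow> \<mu> * (vnorm z)\<^sup>2 \<le> z \<bullet> (H *\<^sub>v z)"
  shows "strongly_convex_fun n \<mu> (quad_fun H b)"
  unfolding strongly_convex_fun_def
proof (intro ballI allI impI)
  fix x y :: "real vec" and t :: real
  assume x: "x \<in> carrier_vec n" and y: "y \<in> carrier_vec n" and t: "0 \<le> t \<and> t \<le> 1"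
  define w where "w = t \<cdot>\<^sub>v x + (1 - t) \<cdot>\<^sub>v y"
  define z where "z = x - y"
  have wz: "w \<in> carrier_vec n" "z \<in> carrier_vec n"
    using x y by (auto simp: w_def z_def)
  have xw: "x = w + (1 - t) \<cdot>\<^sub>v z"
    using x y unfolding w_def z_def by (intro eq_vecI) (auto simp: algebra_simps)
  \<comment> \<open>Both points are expanded around their convex combination \<open>w\<close>; the
    terms linear in \<open>z\<close> then cancel in the weighted sum.\<close>
  have yw: "y = w + (- t) \<cdot>\<^sub>v z"
    using x y unfolding w_def z_def by (intro eq_vecI) (auto simp: algebra_simps)
  define G where "G = (H *\<^sub>v w - b) \<bullet> z"
  define Q where "Q = z \<bullet> (H *\<^sub>v z)"
  define F where "F = quad_fun H b"
  have fx: "F x = F w + (1 - t) * G + (1 - t)\<^sup>2 / 2 * Q"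
    unfolding F_def by (subst xw, subst quad_fun_add_smult[OF H b wz]) (simp add: G_def Q_def)
  have fy: "F y = F w + (- t) * G + (- t)\<^sup>2 / 2 * Q"
    unfolding F_def by (subst yw, subst quad_fun_add_smult[OF H b wz]) (simp add: G_def Q_def)
  have "t * F x + (1 - t) * F y = F w + t * (1 - t) / 2 * Q"
    unfolding fx fy by (simp add: field_simps power2_eq_square)
  moreover have "t * (1 - t) / 2 * (\<mu> * (vnorm z)\<^sup>2) \<le> t * (1 - t) / 2 * Q"
    using mu[OF wz(2)] t unfolding Q_def by (intro mult_left_mono) auto
  ultimately show "quad_fun H b (t \<cdot>\<^sub>v x + (1 - t) \<cdot>\<^sub>v y)
      \<le> t * quad_fun H b x + (1 - t) * quad_fun H b y - \<mu> / 2 * t * (1 - t) * (vnorm (x - y))\<^sup>2"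
    unfolding w_def[symmetric] z_def[symmetric] F_def[symmetric] by (simp add: field_simps)
qed

definition indicator_zero :: "nat \<Rightarrow> real vec \<Rightarrow> ereal" where
  "indicator_zero m u = (if u = 0\<^sub>v m then 0 else \<infinity>)"

lemma proper_fun_indicator_zero: "proper_fun m (indicator_zero m)"
  unfolding proper_fun_def indicator_zero_def by (auto intro!: bexI[of _ "0\<^sub>v m"])

lemma convex_fun_indicator_zero: "convex_fun m (indicator_zero m)"
  unfolding convex_fun_def
proof (intro ballI allI impI)
  fix u v :: "real vec" and t :: real
  assume u: "u \<in> carrier_vec m" and v: "v \<in> carrier_vec m" and t: "0 \<le> t \<and> t \<le> 1"
  \<comment> \<open>In \<open>ereal\<close> the product of 0 and \<infinity> is 0, so the endpoints
    of the segment are separated from the case in which a positive multiple of \<infinity>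
    occurs.\<close>
  consider "u = 0\<^sub>v m" "v = 0\<^sub>v m" | "t = 0" | "t = 1" | "0 < t" "t < 1" "u \<noteq> 0\<^sub>v m \<or> v \<noteq> 0\<^sub>v m"
    using t by fastforce
  then show "indicator_zero m (t \<cdot>\<^sub>v u + (1 - t) \<cdot>\<^sub>v v)
      \<le> ereal t * indicator_zero m u + ereal (1 - t) * indicator_zero m v"
  proof cases
    case 1
    then have "t \<cdot>\<^sub>v u + (1 - t) \<cdot>\<^sub>v v = 0\<^sub>v m" by auto
    with 1 show ?thesis by (simp add: indicator_zero_def)
  next
    case 2
    then have "t \<cdot>\<^sub>v u + (1 - t) \<cdot>\<^sub>v v = v" using u v by auto
    with 2 show ?thesis by (simp add: indicator_zero_def)
  next
    case 3
    then have "t \<cdot>\<^sub>v u + (1 - t) \<cdot>\<^sub>v v = u" using u v by auto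
    with 3 show ?thesis by (simp add: indicator_zero_def)
  next
    case 4
    then have "ereal t * indicator_zero m u + ereal (1 - t) * indicator_zero m v = \<infinity>"
      by (auto simp: indicator_zero_def)
    then show ?thesis by (simp only: ereal_less_eq)
  qed
qed

lemma closed_fun_indicator_zero: "closed_fun m (indicator_zero m)"
  unfolding closed_fun_def
proof (intro allI impI, elim conjE)
  fix U :: "nat \<Rightarrow> real vec" and r :: "nat \<Rightarrow> real" and u s
  assume U: "\<forall>i. U i \<in> carrier_vec m \<and> indicator_zero m (U i) \<le> ereal (r i)"
    and u: "u \<in> carrier_vec m" and lim: "(\<lambda>i. vnorm (U i - u)) \<longlonglongrightarrow> 0" and r: "r \<longlonglongrightarrow> s"
  have Ui: "U i = 0\<^sub>v m \<and> 0 \<le> r i" for i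
    using U[rule_format, of i] by (auto simp: indicator_zero_def split: if_splits)
  then have "(\<lambda>i. vnorm (0\<^sub>v m - u)) \<longlonglongrightarrow> 0" using lim by simp
  then have "vnorm (0\<^sub>v m - u) = 0" by (simp add: LIMSEQ_const_iff)
  then have "0\<^sub>v m - u = 0\<^sub>v m" using u by (simp add: vnorm_eq_0_iff)
  then have "u $ i = 0" if "i < m" for i
    using that u by (metis carrier_vecD diff_0 index_minus_vec(1) index_zero_vec(1) neg_equal_0_iff_equal)
  then have "u = 0\<^sub>v m" using u by (intro eq_vecI) auto
  moreover have "0 \<le> s" using r Ui by (intro LIMSEQ_le_const) auto
  ultimately show "indicator_zero m u \<le> ereal s" by (simp add: indicator_zero_def)
qed

lemma conjugate_fun_indicator_zero: "conjugate_fun m (indicator_zero m) v = 0"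
proof -
  have v0: "v \<bullet> 0\<^sub>v m = 0"
    by (simp add: scalar_prod_def)
  have "(SUP u\<in>carrier_vec m. ereal (v \<bullet> u) - indicator_zero m u) = 0"
  proof (rule antisym)
    show "(SUP u\<in>carrier_vec m. ereal (v \<bullet> u) - indicator_zero m u) \<le> 0"
    proof (rule SUP_least)
      fix u :: "real vec"
      show "ereal (v \<bullet> u) - indicator_zero m u \<le> 0"
        by (cases "u = 0\<^sub>v m") (simp_all add: indicator_zero_def v0)
    qed
    have "ereal (v \<bullet> 0\<^sub>v m) - indicator_zero m (0\<^sub>v m) = 0"
      by (simp add: indicator_zero_def v0)
    then show "0 \<le> (SUP u\<in>carrier_vec m. ereal (v \<bullet> u) - indicator_zero m u)"
      by (intro SUP_upper2[of "0\<^sub>v m"]) simp_all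
  qed
  then show ?thesis unfolding conjugate_fun_def .
qed

text \<open>The conjugate vanishes, so only the squared distance to \<open>v\<close> is minimised.
  For equality constraints the dual update is therefore a plain gradient step, which cannot create
  new nonzero coordinates by itself.\<close>

lemma prox_conjugate_indicator_zero:
  assumes v: "v \<in> carrier_vec m"
  shows "prox m \<eta> (conjugate_fun m (indicator_zero m)) v = v"
  unfolding prox_def conjugate_fun_indicator_zero is_arg_min_def
proof (rule the_equality)
  have *: "v - v = 0\<^sub>v m" using v by auto
  have **: "vnorm (v - v) = 0" unfolding * using vnorm_eq_0_iff[of "0\<^sub>v m"] by simp
  show "v \<in> carrier_vec m \<and> (\<nexists>y. y \<in> carrier_vec m \<and>
      ereal \<eta> * 0 + ereal ((vnorm (y - v))\<^sup>2 / 2) < ereal \<eta> * 0 + ereal ((vnorm (v - v))\<^sup>2 / 2))"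
    using v unfolding ** by (auto simp: not_less)
  fix u assume u: "u \<in> carrier_vec m \<and> (\<nexists>y. y \<in> carrier_vec m \<and>
      ereal \<eta> * 0 + ereal ((vnorm (y - v))\<^sup>2 / 2) < ereal \<eta> * 0 + ereal ((vnorm (u - v))\<^sup>2 / 2))"
  then have "\<not> ereal ((vnorm (v - v))\<^sup>2 / 2) < ereal ((vnorm (u - v))\<^sup>2 / 2)"
    using v by auto
  then have "vnorm (u - v) = 0" using ** by simp
  then have "u - v = 0\<^sub>v m" using u v by (simp add: vnorm_eq_0_iff)
  then have "u $ i = v $ i" if "i < m" for i
    using that u v by (metis carrier_vecD eq_iff_diff_eq_0 index_minus_vec(1) index_zero_vec(1))
  then show "u = v" using u v by (intro eq_vecI) auto
qed

subsection \<open>Condition numbers and optimality\<close>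

text \<open>\<open>min_singular_value\<close> is a \<open>Min\<close> and is meaningful only over a
  nonempty set, while \<open>spectrum\<close> here collects real eigenvalues. A complex eigenvector
  is split into its real and imaginary parts; symmetry forces the imaginary part of the eigenvalue
  to vanish.\<close>

lemma symmetric_spectrum_nonempty:
  fixes A :: "real mat"
  assumes A: "A \<in> carrier_mat n n" and sym: "transpose_mat A = A" and n: "0 < n"
  shows "spectrum A \<noteq> {}"
proof -
  define B where "B = map_mat complex_of_real A"
  have B: "B \<in> carrier_mat n n" using A by (simp add: B_def)
  obtain k v where v: "v \<in> carrier_vec n" "v \<noteq> 0\<^sub>v n" "B *\<^sub>v v = k \<cdot>\<^sub>v v"
    using spectrum_non_empty[OF B n] B unfolding spectrum_def eigenvalue_def eigenvector_def by auto
  define u w where "u = map_vec Re v" and "w = map_vec Im v"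
  have uw: "u \<in> carrier_vec n" "w \<in> carrier_vec n" using v by (auto simp: u_def w_def)
  have Bi: "(\<Sum>j<n. complex_of_real (A $$ (i,j)) * v $ j) = k * v $ i" if "i < n" for i
  proof -
    have "(B *\<^sub>v v) $ i = (\<Sum>j<n. complex_of_real (A $$ (i,j)) * v $ j)"
      using that A v(1) by (simp add: B_def scalar_prod_def lessThan_atLeast0)
    then show ?thesis using that v by simp
  qed
  have Re: "(\<Sum>j<n. A $$ (i,j) * Re (v $ j)) = Re k * Re (v $ i) - Im k * Im (v $ i)" if "i < n" for i
    using arg_cong[OF Bi[OF that], of Re] by simp
  have Im: "(\<Sum>j<n. A $$ (i,j) * Im (v $ j)) = Im k * Re (v $ i) + Re k * Im (v $ i)" if "i < n" for i
    using arg_cong[OF Bi[OF that], of Im] by simp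
  have Au: "A *\<^sub>v u = Re k \<cdot>\<^sub>v u - Im k \<cdot>\<^sub>v w"
    using A v(1) Re by (intro eq_vecI) (auto simp: u_def w_def scalar_prod_def lessThan_atLeast0)
  have Aw: "A *\<^sub>v w = Im k \<cdot>\<^sub>v u + Re k \<cdot>\<^sub>v w"
    using A v(1) Im by (intro eq_vecI) (auto simp: u_def w_def scalar_prod_def lessThan_atLeast0)
  have "(A *\<^sub>v u) \<bullet> w = u \<bullet> (A *\<^sub>v w)"
    using transpose_vec_mult_scalar[OF A uw(2) uw(1)] sym by simp
  then have "Im k * (u \<bullet> u + w \<bullet> w) = 0"
    unfolding Au Aw using uw
    by (simp add: minus_scalar_prod_distrib[of _ n] scalar_prod_add_distrib[of _ n]
      smult_scalar_prod_distrib[of _ n] scalar_prod_smult_distrib[of _ n] algebra_simps)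
  moreover have "u \<noteq> 0\<^sub>v n \<or> w \<noteq> 0\<^sub>v n"
  proof (rule ccontr)
    assume "\<not> ?thesis"
    then have "Re (v $ i) = 0 \<and> Im (v $ i) = 0" if "i < n" for i
      using that v(1) unfolding u_def w_def by (metis carrier_vecD index_map_vec(1) index_zero_vec(1))
    then have "v = 0\<^sub>v n" using v(1) by (intro eq_vecI) (auto simp: complex_eq_iff)
    with v(2) show False ..
  qed
  then have "vnorm u \<noteq> 0 \<or> vnorm w \<noteq> 0" using uw by (simp add: vnorm_eq_0_iff)
  then have "u \<bullet> u + w \<bullet> w \<noteq> 0"
    by (metis vnorm_squared sum_power2_eq_zero_iff)
  ultimately have "Im k = 0" by simp
  then have "A *\<^sub>v u = Re k \<cdot>\<^sub>v u" "A *\<^sub>v w = Re k \<cdot>\<^sub>v w"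
    unfolding Au Aw using uw by (auto intro!: eq_vecI)
  with \<open>u \<noteq> 0\<^sub>v n \<or> w \<noteq> 0\<^sub>v n\<close> uw A have "eigenvalue A (Re k)"
    unfolding eigenvalue_def eigenvector_def by auto
  then show ?thesis unfolding spectrum_def by auto
qed

text \<open>For an eigenvector \<open>l\<close> of the Gram matrix with eigenvalue \<open>k\<close>,
  \<open>k\<close> times the squared norm of \<open>l\<close> is the squared norm of its image under
  the transpose. The operator norm is bounded by moving one factor of the squared norm of
  \<open>A v\<close> to the transpose. Two-sided bounds on the transpose thus settle both
  quantities.\<close>

lemma cond_number_le:
  assumes A: "A \<in> carrier_mat p n" and p: "0 < p" "p \<le> n" and c: "0 < c1" "0 \<le> c2"
    and lower: "\<And>l. l \<in> carrier_vec p \<Longrightarrow> c1 * vnorm l \<le> vnorm (transpose_mat A *\<^sub>v l)"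
    and upper: "\<And>l. l \<in> carrier_vec p \<Longrightarrow> vnorm (transpose_mat A *\<^sub>v l) \<le> c2 * vnorm l"
  shows "0 < min_singular_value A" "cond_number A \<le> c2 / c1"
proof -
  define M where "M = A * transpose_mat A"
  have M: "M \<in> carrier_mat p p" using A by (simp add: M_def)
  have symM: "transpose_mat M = M"
    unfolding M_def using A by (subst transpose_mult[of _ p n]) auto
  have sv: "singular_values A = sqrt ` spectrum M"
    unfolding singular_values_def M_def using A p by auto
  have fin: "finite (singular_values A)" unfolding sv using card_finite_spectrum(1)[OF M] by simp
  have ne: "singular_values A \<noteq> {}"
    unfolding sv using symmetric_spectrum_nonempty[OF M symM p(1)] by simp
  have ge: "c1 \<le> s" if s_sv: "s \<in> singular_values A" for s
  proof -
    obtain k where s: "s = sqrt k" and "eigenvalue M k"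
      using s_sv unfolding sv spectrum_def by auto
    then obtain l where l: "l \<in> carrier_vec p" "l \<noteq> 0\<^sub>v p" "M *\<^sub>v l = k \<cdot>\<^sub>v l"
      using M unfolding eigenvalue_def eigenvector_def by auto
    have Atl: "transpose_mat A *\<^sub>v l \<in> carrier_vec n" using A l by simp
    have l0: "0 < vnorm l" using vnorm_eq_0_iff[of l] vnorm_nonneg[of l] l by simp
    have Ml: "M *\<^sub>v l = A *\<^sub>v (transpose_mat A *\<^sub>v l)"
      unfolding M_def using A l by (intro assoc_mult_mat_vec) auto
    have "k * (vnorm l)\<^sup>2 = l \<bullet> (k \<cdot>\<^sub>v l)"
      using l(1) by (simp add: vnorm_squared)
    also have "\<dots> = l \<bullet> (A *\<^sub>v (transpose_mat A *\<^sub>v l))"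
      by (simp only: Ml flip: l(3))
    also have "\<dots> = (vnorm (transpose_mat A *\<^sub>v l))\<^sup>2"
      using transpose_vec_mult_scalar[OF A Atl l(1)] by (simp add: vnorm_squared)
    also have "\<dots> \<ge> (c1 * vnorm l)\<^sup>2"
      using lower[OF l(1)] c l0 by (intro power_mono) auto
    finally have "c1\<^sup>2 \<le> k" using l0 by (simp add: power_mult_distrib)
    then show ?thesis using c unfolding s by (simp add: real_le_rsqrt)
  qed
  then have min: "c1 \<le> min_singular_value A"
    unfolding min_singular_value_def using fin ne by simp
  then show "0 < min_singular_value A" using c by simp
  have "op_norm A \<le> c2"
    unfolding op_norm_def
  proof (rule cSup_least)
    have "vnorm (0\<^sub>v n) = 0" using vnorm_eq_0_iff[of "0\<^sub>v n"] by simp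
    then show "{vnorm (A *\<^sub>v v) |v. v \<in> carrier_vec (dim_col A) \<and> vnorm v \<le> 1} \<noteq> {}"
      using A by (auto intro!: exI[of _ "0\<^sub>v n"])
    fix s assume "s \<in> {vnorm (A *\<^sub>v v) |v. v \<in> carrier_vec (dim_col A) \<and> vnorm v \<le> 1}"
    then obtain v where s: "s = vnorm (A *\<^sub>v v)" and v: "v \<in> carrier_vec n" "vnorm v \<le> 1"
      using A by auto
    have Av: "A *\<^sub>v v \<in> carrier_vec p" using A v by simp
    have "s * s = (transpose_mat A *\<^sub>v (A *\<^sub>v v)) \<bullet> v"
      using transpose_vec_mult_scalar[OF A v(1) Av] by (simp add: s vnorm_squared flip: power2_eq_square)
    also have "\<dots> \<le> vnorm (transpose_mat A *\<^sub>v (A *\<^sub>v v)) * vnorm v"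
      using scalar_prod_le_vnorm[of "transpose_mat A *\<^sub>v (A *\<^sub>v v)" n v] A v by auto
    also have "\<dots> \<le> (c2 * s) * 1"
      using upper[OF Av] v c by (intro mult_mono) (auto simp: s vnorm_nonneg)
    finally have "s * s \<le> c2 * s" by simp
    then show "s \<le> c2"
      using vnorm_nonneg[of "A *\<^sub>v v"] c unfolding s by (cases "vnorm (A *\<^sub>v v) = 0") auto
  qed
  then have "cond_number A \<le> c2 / min_singular_value A"
    unfolding cond_number_def using min c by (intro divide_right_mono) auto
  also have "\<dots> \<le> c2 / c1" using min c by (intro divide_left_mono) auto
  finally show "cond_number A \<le> c2 / c1" .
qed

text \<open>The multiplier puts the gradient into the range of the transpose, hence orthogonal to
  the kernel of \<open>A\<close>. Along feasible directions only the nonnegative quadratic term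
  remains.\<close>

lemma optimal_solution_quadI:
  assumes H: "H \<in> carrier_mat n n" "transpose_mat H = H" and b: "b \<in> carrier_vec n"
    and pos: "\<And>z. z \<in> carrier_vec n \<Longrightarrow> 0 \<le> z \<bullet> (H *\<^sub>v z)"
    and A: "A \<in> carrier_mat p n" and x: "x \<in> carrier_vec n" "A *\<^sub>v x = 0\<^sub>v p"
    and l: "l \<in> carrier_vec p" "H *\<^sub>v x - b = transpose_mat A *\<^sub>v l"
  shows "optimal_solution \<lparr>obj = quad_fun H b, reg = indicator_zero p, cmat = A, rhs = 0\<^sub>v p\<rparr> x"
proof -
  let ?P = "\<lparr>obj = quad_fun H b, reg = indicator_zero p, cmat = A, rhs = 0\<^sub>v p\<rparr>"
  have z0: "0\<^sub>v p - 0\<^sub>v p = (0\<^sub>v p :: real vec)" by auto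
  have ox: "objective ?P x = ereal (quad_fun H b x)"
    using x z0 by (simp add: objective_def indicator_zero_def)
  have "objective ?P x \<le> objective ?P y" if y: "y \<in> carrier_vec n" for y
  proof (cases "A *\<^sub>v y = 0\<^sub>v p")
    case True
    define z where "z = y - x"
    have z: "z \<in> carrier_vec n" using x y by (simp add: z_def)
    have "A *\<^sub>v z = 0\<^sub>v p"
      unfolding z_def using mult_minus_distrib_mat_vec[OF A y x(1)] True x(2) z0 by simp
    then have "(H *\<^sub>v x - b) \<bullet> z = 0"
      unfolding l(2) using transpose_vec_mult_scalar[OF A z l(1)] l by simp
    moreover have "y = x + 1 \<cdot>\<^sub>v z" unfolding z_def by (rule add_smult_minus[OF x(1) y])
    ultimately have "quad_fun H b x \<le> quad_fun H b y"
      using quad_fun_add_smult[OF H b x(1) z, of 1] pos[OF z] by simp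
    then show ?thesis unfolding ox using True z0 by (simp add: objective_def indicator_zero_def)
  next
    case False
    have "A *\<^sub>v y - 0\<^sub>v p = A *\<^sub>v y" using A y by auto
    then show ?thesis using False by (simp add: objective_def indicator_zero_def)
  qed
  then show ?thesis
    unfolding optimal_solution_def is_arg_min_def using x(1) A ox by (auto simp: not_less)
qed

subsection \<open>The chain instance\<close>

lemma sum_if_less: "(\<Sum>c<p + d. if c < p then f c else 0) = (\<Sum>c<p. f c)"
  for f :: "nat \<Rightarrow> real"
  by (induction d) auto

lemma sum_if_ge: "(\<Sum>c<p + d. if d \<le> c then f (c - d) else 0) = (\<Sum>c<p. f c)"
  for f :: "nat \<Rightarrow> real"
  by (induction p) auto

text \<open>Indices run layer by layer, whereas the estimates are made block by block; this
  exchanges the two orders.\<close>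

lemma sum_blocks: "(\<Sum>c<k * d. f c) = (\<Sum>j<d. \<Sum>i<k. f (i * d + j))"
  for f :: "nat \<Rightarrow> real"
proof -
  have "sum f {a..<a + d} = (\<Sum>j<d. f (a + j))" for a
    using sum.shift_bounds_nat_ivl[of f 0 a d] by (simp add: lessThan_atLeast0 add.commute)
  then have "(\<Sum>c<k * d. f c) = (\<Sum>i<k. \<Sum>j<d. f (i * d + j))"
    by (simp flip: sum.nat_group)
  then show ?thesis by (simp add: sum.swap[of _ "{..<k}"])
qed

lemma sum_mult_squared_le:
  fixes f g :: "'a \<Rightarrow> real"
  shows "(\<Sum>i\<in>I. f i * g i)\<^sup>2 \<le> (\<Sum>i\<in>I. (f i)\<^sup>2) * (\<Sum>i\<in>I. (g i)\<^sup>2)"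
proof -
  have "\<bar>\<Sum>i\<in>I. f i * g i\<bar> \<le> (\<Sum>i\<in>I. \<bar>f i\<bar> * \<bar>g i\<bar>)"
    unfolding abs_mult[symmetric] by (rule sum_abs)
  also have "\<dots> \<le> L2_set f I * L2_set g I" by (rule L2_set_mult_ineq)
  finally have "(\<Sum>i\<in>I. f i * g i)\<^sup>2 \<le> (L2_set f I * L2_set g I)\<^sup>2"
    by (metis abs_ge_zero power2_abs power_mono)
  then show ?thesis
    by (simp add: L2_set_def power_mult_distrib sum_nonneg)
qed

text \<open>
  There are \<open>e + 2\<close> layers of \<open>d\<close> coordinates each; the index \<open>i * d + j\<close> denotes the \<open>j\<close>-th
  coordinate of layer \<open>i\<close>, so a block consists of the indices with the same \<open>j\<close>. On the kernel of
  \<open>A\<close> below every block is a multiple of \<open>(1, r, \<dots>, r, 1)\<close>. The small inner entries keep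
  the squared norm of this vector below \<open>3\<close>, so that the strong convexity of the middle layers does
  not spoil the conditioning of the reduced problem.
\<close>

locale chain =
  fixes e d :: nat and r \<mu> K q Y :: real
  assumes d_pos: "0 < d" and r_pos: "0 < r" and r_sq: "r\<^sup>2 * real (e + 2) = 1"
    and mu_pos: "0 < \<mu>" and K_pos: "0 < K" and q_pos: "0 < q" and q_less_1: "q < 1"
    and recurrence: "K * (q + 1 / q - 2) = \<mu> * (2 + real e * r\<^sup>2)"
begin

definition n :: nat where "n = (e + 2) * d"
definition p :: nat where "p = (e + 1) * d"

lemma n_eq: "n = p + d" and p_eq: "p = e * d + d"
  by (simp_all add: n_def p_def)

lemma dims: "0 < p" "0 < n" "p \<le> n" "d \<le> p"
  using d_pos by (auto simp: n_def p_def)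

text \<open>
  The objective couples the end of block \<open>j\<close> with the start of block \<open>j + 1\<close>. The weights \<open>0\<close> and
  \<open>q\<close> at the two unpaired ends make the geometric sequence solve the boundary equations exactly.
\<close>

definition partner :: "nat \<Rightarrow> nat" where
  "partner c = (if p \<le> c \<and> Suc c < n then Suc c - p
     else if 0 < c \<and> c < d then c + p - 1 else c)"

definition weight :: "nat \<Rightarrow> real" where
  "weight c = (if c = 0 then 0 else if Suc c = n then q else 1)"

text \<open>An inner coordinate is its own partner with weight 1, so \<open>K\<close> cancels on the
  diagonal there and only \<mu> is left; \<open>K\<close> acts on the two end layers alone.\<close>

definition H :: "real mat" where
  "H = mat n n (\<lambda>(c, k). (if k = c then \<mu> + K else 0) - (if k = partner c then K * weight c else 0))"

text \<open>Only the first and the last link of a block carry \<open>r\<close>. For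
  \<open>e = 0\<close> these are the same link, which gets \<open>r\<close> on both sides; since
  \<open>2 * r^2 = 1\<close>, the rows of \<open>A\<close> are then orthonormal.\<close>

definition coef_l :: "nat \<Rightarrow> real" where "coef_l i = (if i < d then r else 1)"
definition coef_r :: "nat \<Rightarrow> real" where "coef_r i = (if e * d \<le> i then r else 1)"

definition A :: "real mat" where
  "A = mat p n (\<lambda>(i, c). (if c = i then coef_l i else 0) - (if c = i + d then coef_r i else 0))"

text \<open>The entry is \<open>K\<close> times \<open>Y / q\<close>, the value that the geometric
  sequence would take in a block before the first one. It is the only source of nonzero
  coordinates.\<close>

definition b :: "real vec" where
  "b = vec n (\<lambda>c. if c = 0 then K * Y / q else 0)"

definition xs :: "real vec" where
  "xs = vec n (\<lambda>c. (if d \<le> c \<and> c < p then r else 1) * (Y * q ^ (c mod d)))"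

text \<open>The Lagrange multiplier certifying optimality of \<open>xs\<close>.\<close>

definition lam :: "real vec" where
  "lam = vec p (\<lambda>i. ((\<mu> + K - K / q) / r + real (i div d) * \<mu> * r) * (Y * q ^ (i mod d)))"

definition prob :: problem where
  "prob = \<lparr>obj = quad_fun H b, reg = indicator_zero p, cmat = A, rhs = 0\<^sub>v p\<rparr>"

lemma carriers [simp]:
  "H \<in> carrier_mat n n" "A \<in> carrier_mat p n" "b \<in> carrier_vec n" "xs \<in> carrier_vec n"
  "lam \<in> carrier_vec p"
  by (simp_all add: H_def A_def b_def xs_def lam_def)

lemma dims_mat [simp]:
  "dim_row H = n" "dim_col H = n" "dim_row A = p" "dim_col A = n"
  "dim_vec b = n" "dim_vec xs = n" "dim_vec lam = p"
  by (simp_all add: H_def A_def b_def xs_def lam_def)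

lemma partner_less: "c < n \<Longrightarrow> partner c < n"
  using dims n_eq by (auto simp: partner_def)

lemma partner_partner: "c < n \<Longrightarrow> partner (partner c) = c"
  using dims n_eq d_pos by (auto simp: partner_def)

lemma weight_partner: "c < n \<Longrightarrow> weight (partner c) = weight c"
  using dims n_eq d_pos by (auto simp: partner_def weight_def)

lemma weight_bounds: "0 \<le> weight c" "weight c \<le> 1"
  using q_pos q_less_1 by (auto simp: weight_def)

lemma bij_partner: "bij_betw partner {..<n} {..<n}"
  by (rule bij_betwI[where g = partner]) (auto simp: partner_less partner_partner)

lemma transpose_H: "transpose_mat H = H"
proof (rule eq_matI)
  fix i j assume "i < dim_row H" "j < dim_col H"
  then have ij: "i < n" "j < n" by auto
  have "i = partner j \<longleftrightarrow> j = partner i"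
    using partner_partner ij by metis
  moreover have "weight j = weight i" if "j = partner i"
    using that weight_partner[OF ij(1)] by simp
  ultimately show "transpose_mat H $$ (i, j) = H $$ (i, j)"
    using ij by (auto simp: H_def)
qed auto

lemma H_mult_index:
  assumes x: "x \<in> carrier_vec n" and c: "c < n"
  shows "(H *\<^sub>v x) $ c = (\<mu> + K) * x $ c - K * weight c * x $ partner c"
proof -
  have "(H *\<^sub>v x) $ c = (\<Sum>k<n. (if k = c then (\<mu> + K) * x $ k else 0) -
      (if k = partner c then K * weight c * x $ k else 0))"
    using x c by (auto simp: H_def scalar_prod_def lessThan_atLeast0 algebra_simps intro!: sum.cong)
  also have "\<dots> = (\<mu> + K) * x $ c - K * weight c * x $ partner c"
    using c partner_less[OF c] by (simp add: sum_subtractf)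
  finally show ?thesis .
qed

lemma A_mult_index:
  assumes x: "x \<in> carrier_vec n" and i: "i < p"
  shows "(A *\<^sub>v x) $ i = coef_l i * x $ i - coef_r i * x $ (i + d)"
proof -
  have "(A *\<^sub>v x) $ i = (\<Sum>k<n. (if k = i then coef_l i * x $ k else 0) -
      (if k = i + d then coef_r i * x $ k else 0))"
    using x i by (auto simp: A_def scalar_prod_def lessThan_atLeast0 algebra_simps intro!: sum.cong)
  also have "\<dots> = coef_l i * x $ i - coef_r i * x $ (i + d)"
    using i n_eq by (simp add: sum_subtractf)
  finally show ?thesis .
qed

lemma At_mult_index:
  assumes l: "l \<in> carrier_vec p" and c: "c < n"
  shows "(transpose_mat A *\<^sub>v l) $ c =
    (if c < p then coef_l c * l $ c else 0) - (if d \<le> c then coef_r (c - d) * l $ (c - d) else 0)"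
proof -
  have "(transpose_mat A *\<^sub>v l) $ c = (\<Sum>i<p. (if i = c then coef_l i * l $ i else 0) -
      (if d \<le> c \<and> i = c - d then coef_r i * l $ i else 0))"
    using l c by (auto simp: A_def scalar_prod_def lessThan_atLeast0 algebra_simps intro!: sum.cong)
  also have "\<dots> = (if c < p then coef_l c * l $ c else 0) -
      (if d \<le> c then coef_r (c - d) * l $ (c - d) else 0)"
    using c n_eq by (auto simp: sum_subtractf)
  finally show ?thesis .
qed

lemma sum_partner: "(\<Sum>c<n. f (partner c)) = (\<Sum>c<n. f c :: real)"
  by (rule sum.reindex_bij_betw[OF bij_partner])

section \<open>Spectral bounds of the objective\<close>

text \<open>\<open>H\<close> is \<open>(\<mu> + K)\<close> times the identity minus \<open>K\<close>
  times a weighted permutation; as the weights lie between 0 and 1, the latter has norm at most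
  1.\<close>

lemma H_upper:
  assumes z: "z \<in> carrier_vec n"
  shows "vnorm (H *\<^sub>v z) \<le> (\<mu> + 2 * K) * vnorm z"
proof -
  define T where "T c = weight c * z $ partner c" for c
  have "(\<Sum>c<n. (T c)\<^sup>2) \<le> (\<Sum>c<n. (z $ partner c)\<^sup>2)"
    unfolding T_def power_mult_distrib
    by (intro sum_mono mult_left_le_one_le) (auto simp: weight_bounds power_le_one)
  also have "\<dots> = (\<Sum>c<n. (z $ c)\<^sup>2)"
    by (rule sum_partner)
  finally have T: "L2_set T {..<n} \<le> vnorm z"
    using z by (simp add: vnorm_L2_set L2_set_def)
  have "vnorm (H *\<^sub>v z) = L2_set (\<lambda>c. (\<mu> + K) * z $ c + (- K) * T c) {..<n}"
    unfolding vnorm_L2_set by (rule L2_set_cong) (use z in \<open>auto simp: H_mult_index T_def simp del: index_mult_mat_vec\<close>)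
  also have "\<dots> \<le> L2_set (\<lambda>c. (\<mu> + K) * z $ c) {..<n} + L2_set (\<lambda>c. (- K) * T c) {..<n}"
    by (rule L2_set_triangle_ineq)
  also have "L2_set (\<lambda>c. (\<mu> + K) * z $ c) {..<n} = (\<mu> + K) * vnorm z"
    using mu_pos K_pos z by (simp add: L2_set_right_distrib vnorm_L2_set)
  also have "L2_set (\<lambda>c. (- K) * T c) {..<n} = K * L2_set T {..<n}"
    using K_pos by (simp add: L2_set_right_distrib L2_set_def power_mult_distrib
      real_sqrt_mult flip: sum_distrib_left)
  also have "\<dots> \<le> K * vnorm z"
    using T K_pos by (intro mult_left_mono) auto
  finally show ?thesis by (simp add: algebra_simps)
qed

text \<open>By the inequality of arithmetic and geometric means on each pair, and because
  \<open>partner\<close> permutes the squares, the coupling loses at most what \<open>K\<close>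
  contributes on the diagonal.\<close>

lemma H_lower:
  assumes z: "z \<in> carrier_vec n"
  shows "\<mu> * (vnorm z)\<^sup>2 \<le> z \<bullet> (H *\<^sub>v z)"
proof -
  have *: "w * (x * y) \<le> (x\<^sup>2 + y\<^sup>2) / 2" if "0 \<le> w" "w \<le> 1" for w x y :: real
  proof -
    have "w * (x * y) \<le> w * ((x\<^sup>2 + y\<^sup>2) / 2)"
      using that sum_squares_bound[of x y] by (intro mult_left_mono) auto
    also have "\<dots> \<le> 1 * ((x\<^sup>2 + y\<^sup>2) / 2)"
      using that by (intro mult_right_mono) auto
    finally show ?thesis by simp
  qed
  have "(\<Sum>c<n. weight c * (z $ c * z $ partner c)) \<le> (\<Sum>c<n. ((z $ c)\<^sup>2 + (z $ partner c)\<^sup>2) / 2)"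
    by (intro sum_mono * weight_bounds)
  also have "\<dots> = (vnorm z)\<^sup>2"
    using z sum_partner[of "\<lambda>c. (z $ c)\<^sup>2"]
    by (simp add: vnorm_squared_sum sum.distrib flip: sum_divide_distrib)
  finally have "K * (\<Sum>c<n. weight c * (z $ c * z $ partner c)) \<le> K * (vnorm z)\<^sup>2"
    using K_pos by simp
  moreover have "z \<bullet> (H *\<^sub>v z) = (\<Sum>c<n. z $ c * ((\<mu> + K) * z $ c - K * weight c * z $ partner c))"
    using z by (auto simp: scalar_prod_def lessThan_atLeast0 H_mult_index simp del: index_mult_mat_vec
      intro!: sum.cong)
  moreover have "\<dots> = (\<Sum>c<n. (\<mu> + K) * (z $ c)\<^sup>2 - K * (weight c * (z $ c * z $ partner c)))"
    by (intro sum.cong) (auto simp: power2_eq_square algebra_simps)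
  moreover have "\<dots> = (\<mu> + K) * (vnorm z)\<^sup>2 - K * (\<Sum>c<n. weight c * (z $ c * z $ partner c))"
    using z by (simp add: vnorm_squared_sum sum_subtractf sum_distrib_left)
  ultimately show ?thesis by (simp add: algebra_simps)
qed

section \<open>Optimality of the geometric solution\<close>

lemma A_xs: "A *\<^sub>v xs = 0\<^sub>v p"
proof (rule eq_vecI)
  fix i assume "i < dim_vec (0\<^sub>v p)"
  then have i: "i < p" by simp
  have l: "coef_l i * xs $ i = r * (Y * q ^ (i mod d))"
    using i dims by (auto simp: coef_l_def xs_def)
  have r: "coef_r i * xs $ (i + d) = r * (Y * q ^ (i mod d))"
    using i n_eq p_eq by (auto simp: coef_r_def xs_def)
  show "(A *\<^sub>v xs) $ i = 0\<^sub>v p $ i"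
    using i l r by (simp add: A_mult_index del: index_mult_mat_vec)
qed auto

text \<open>The first layer determines the first entries of \<open>lam\<close>, and each inner layer
  adds \<open>\<mu> * r\<close> times the block value. The equations of the last layer are then all
  that is left, and they amount to \<open>recurrence\<close>.\<close>

lemma gradient_xs: "H *\<^sub>v xs - b = transpose_mat A *\<^sub>v lam"
proof (rule eq_vecI)
  fix c assume "c < dim_vec (transpose_mat A *\<^sub>v lam)"
  then have c: "c < n" by simp
  have lhs: "(H *\<^sub>v xs - b) $ c = (\<mu> + K) * xs $ c - K * weight c * xs $ partner c - b $ c"
    using c by (simp add: H_mult_index del: index_mult_mat_vec)
  note rhs = At_mult_index[OF carriers(5) c]
  have pmod: "p mod d = 0" by (simp add: p_def)
  consider "c = 0" | "0 < c" "c < d" | "d \<le> c" "c < p" | "p \<le> c" by linarith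
  then show "(H *\<^sub>v xs - b) $ c = (transpose_mat A *\<^sub>v lam) $ c"
  proof cases
    case 1
    then show ?thesis unfolding lhs rhs
      using d_pos dims r_pos by (simp add: weight_def b_def xs_def lam_def coef_l_def field_simps)
  next
    case 2
    then obtain k where k: "c = Suc k" by (cases c) auto
    have pc: "partner c = p + k" using 2 dims by (auto simp: partner_def k)
    have "(p + k) mod d = k"
      using 2 pmod k by (metis Suc_lessD add_cancel_right_left mod_add_left_eq mod_less)
    then have "xs $ (p + k) = Y * q ^ k" using 2 n_eq by (simp add: xs_def k)
    moreover have "xs $ c = Y * q ^ c" "r * lam $ c = (\<mu> + K) * (Y * q ^ c) - K * (Y * q ^ k)"
      using 2 dims n_eq q_pos r_pos by (auto simp: xs_def lam_def k field_simps)
    ultimately show ?thesis unfolding lhs rhs pc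
      using 2 dims n_eq by (simp add: k weight_def b_def coef_l_def)
  next
    case 3
    have "partner c = c" "weight c = 1"
      using 3 dims n_eq d_pos by (auto simp: partner_def weight_def)
    moreover obtain k where k: "c = d + k" using 3 le_Suc_ex by blast
    then have "k < e * d" using 3 p_eq by simp
    moreover have "xs $ c = r * (Y * q ^ (k mod d))" "b $ c = 0"
      using 3 c k d_pos by (simp_all add: xs_def b_def)
    moreover have "lam $ c - lam $ k = \<mu> * r * (Y * q ^ (k mod d))"
      using 3 c k d_pos by (simp add: lam_def algebra_simps)
    ultimately show ?thesis unfolding lhs rhs
      using 3 d_pos by (simp add: k coef_l_def coef_r_def algebra_simps)
  next
    case 4
    define j where "j = c - p"
    have j: "c = p + j" "j < d" using 4 c n_eq by (auto simp: j_def)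
    have cm: "c mod d = j" using j pmod by (metis add_cancel_right_left mod_add_left_eq mod_less)
    have cd: "c - d = e * d + j" using j p_eq by simp
    then have cdm: "(c - d) mod d = j" "(c - d) div d = e" using j by auto
    \<comment> \<open>At the very last coordinate the weight \<open>q\<close> on the coordinate
      itself imitates the missing next block, whose value would be \<open>Y * q ^ d\<close>.\<close>
    have L: "weight c * xs $ partner c = q * (Y * q ^ j)"
    proof (cases "Suc c < n")
      case True
      then have "partner c = Suc j" "weight c = 1" "Suc j < d"
        using 4 j n_eq dims by (auto simp: partner_def weight_def)
      then show ?thesis using True dims n_eq by (simp add: xs_def)
    next
      case False
      then have "partner c = c" "weight c = q"
        using 4 c dims n_eq d_pos by (auto simp: partner_def weight_def)
      then show ?thesis using c 4 cm by (simp add: xs_def)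
    qed
    have "r * ((\<mu> + K - K / q) / r + real e * \<mu> * r) = \<mu> + K - K / q + real e * \<mu> * r\<^sup>2"
      using r_pos by (simp add: field_simps power2_eq_square)
    also have "\<dots> = - (\<mu> + K - K * q)"
      using recurrence by (simp add: algebra_simps)
    finally have R: "r * ((\<mu> + K - K / q) / r + real e * \<mu> * r) = - (\<mu> + K - K * q)" .
    have "(transpose_mat A *\<^sub>v lam) $ c = - (r * lam $ (c - d))"
      unfolding rhs using 4 dims cd by (simp add: coef_r_def)
    also have "lam $ (c - d) = ((\<mu> + K - K / q) / r + real e * \<mu> * r) * (Y * q ^ j)"
      using c n_eq 4 dims cdm by (simp add: lam_def)
    finally have "(transpose_mat A *\<^sub>v lam) $ c =
        - (r * ((\<mu> + K - K / q) / r + real e * \<mu> * r)) * (Y * q ^ j)"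
      by simp
    then have "(transpose_mat A *\<^sub>v lam) $ c = (\<mu> + K - K * q) * (Y * q ^ j)"
      unfolding R by simp
    moreover have "(H *\<^sub>v xs - b) $ c = (\<mu> + K) * (Y * q ^ j) - K * (q * (Y * q ^ j))"
      unfolding lhs mult.assoc L using c 4 dims cm by (simp add: b_def xs_def)
    ultimately show ?thesis by (simp add: algebra_simps)
  qed
qed auto

lemma optimal_solution_xs: "optimal_solution prob xs"
  unfolding prob_def
proof (rule optimal_solution_quadI[OF _ transpose_H])
  fix z :: "real vec" assume "z \<in> carrier_vec n"
  then show "0 \<le> z \<bullet> (H *\<^sub>v z)"
    using H_lower[of z] mu_pos by (smt (verit) mult_nonneg_nonneg zero_le_power2)
qed (auto simp: A_xs gradient_xs)

section \<open>Condition number of the constraint matrix\<close>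

lemma r_le_1: "r \<le> 1"
proof (rule ccontr)
  assume "\<not> r \<le> 1"
  then have "1 < r\<^sup>2" by (simp add: one_less_power)
  moreover have "r\<^sup>2 * 1 \<le> r\<^sup>2 * real (e + 2)" by (intro mult_left_mono) auto
  ultimately show False using r_sq by simp
qed

lemma vnorm_At_le:
  assumes l: "l \<in> carrier_vec p"
  shows "vnorm (transpose_mat A *\<^sub>v l) \<le> 2 * vnorm l"
proof -
  define f g where "f c = (if c < p then coef_l c * l $ c else 0)"
    and "g c = (if d \<le> c then coef_r (c - d) * l $ (c - d) else 0)" for c
  have le: "(w * x)\<^sup>2 \<le> x\<^sup>2" if "0 \<le> w" "w \<le> 1" for w x :: real
    using that by (simp add: power_mult_distrib mult_left_le_one_le power_le_one)
  have "(\<Sum>c<n. (f c)\<^sup>2) = (\<Sum>c<p + d. if c < p then (coef_l c * l $ c)\<^sup>2 else 0)"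
    unfolding n_eq by (intro sum.cong) (auto simp: f_def)
  also have "\<dots> \<le> (\<Sum>c<p. (l $ c)\<^sup>2)"
    unfolding sum_if_less using r_pos r_le_1 by (intro sum_mono le) (auto simp: coef_l_def)
  finally have f: "L2_set f {..<n} \<le> vnorm l"
    using l by (simp add: vnorm_L2_set L2_set_def)
  have "(\<Sum>c<n. (g c)\<^sup>2) = (\<Sum>c<p + d. if d \<le> c then (coef_r (c - d) * l $ (c - d))\<^sup>2 else 0)"
    unfolding n_eq by (intro sum.cong) (auto simp: g_def)
  also have "\<dots> = (\<Sum>c<p. (coef_r c * l $ c)\<^sup>2)"
    by (rule sum_if_ge[where f = "\<lambda>c. (coef_r c * l $ c)\<^sup>2"])
  also have "\<dots> \<le> (\<Sum>c<p. (l $ c)\<^sup>2)"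
    using r_pos r_le_1 by (intro sum_mono le) (auto simp: coef_r_def)
  finally have g: "L2_set (\<lambda>c. - g c) {..<n} \<le> vnorm l"
    using l by (simp add: vnorm_L2_set L2_set_def)
  have "vnorm (transpose_mat A *\<^sub>v l) = L2_set (\<lambda>c. f c + - g c) {..<n}"
    unfolding vnorm_L2_set
    by (rule L2_set_cong) (use l in \<open>auto simp: At_mult_index f_def g_def simp del: index_mult_mat_vec\<close>)
  also have "\<dots> \<le> L2_set f {..<n} + L2_set (\<lambda>c. - g c) {..<n}"
    by (rule L2_set_triangle_ineq)
  finally show ?thesis using f g by simp
qed

text \<open>Within a block the transpose takes differences of neighbouring multipliers, so they are
  recovered by summing up from the first layer. Cauchy-Schwarz on these at most \<open>e + 1\<close>
  terms gives one factor of order \<open>e + 2\<close>, and summing over the layers gives the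
  other.\<close>

lemma vnorm_le_At:
  assumes l: "l \<in> carrier_vec p"
  shows "vnorm l \<le> sqrt 2 * real (e + 2) * vnorm (transpose_mat A *\<^sub>v l)"
proof -
  define w where "w = transpose_mat A *\<^sub>v l"
  define s :: "nat \<Rightarrow> real" where "s i = (if i = 0 then 1 / r else 1)" for i
  define W where "W j = (\<Sum>i<e + 2. (w $ (i * d + j))\<^sup>2)" for j
  have idx: "i * d + j < k * d" if "i < k" "j < d" for i j k
  proof -
    have "i * d + j < Suc i * d" using that by simp
    also have "\<dots> \<le> k * d" using that by (intro mult_le_mono1) simp
    finally show ?thesis .
  qed
  have w0: "w $ j = r * l $ j" if "j < d" for j
    using that dims n_eq l by (simp add: w_def At_mult_index coef_l_def del: index_mult_mat_vec)
  have w1: "w $ (Suc i * d + j) = l $ (Suc i * d + j) - l $ (i * d + j)" if "j < d" "Suc i \<le> e" for i j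
  proof -
    have "Suc i * d + j < p" using idx[of "Suc i" "e + 1" j] that by (simp add: p_def)
    moreover have "i * d + j < e * d" using idx[of i e j] that by simp
    ultimately show ?thesis
      using l n_eq by (simp add: w_def At_mult_index coef_l_def coef_r_def del: index_mult_mat_vec)
  qed
  have tele: "l $ (i * d + j) = (\<Sum>k<Suc i. s k * w $ (k * d + j))" if "j < d" "i \<le> e" for i j
    using that(2)
  proof (induction i)
    case 0
    then show ?case using w0[OF that(1)] r_pos by (simp add: s_def)
  next
    case (Suc i)
    then show ?case using w1[OF that(1), of i] by (simp add: s_def)
  qed
  \<comment> \<open>Starting the sum costs the square of \<open>1 / r\<close>, which is
    \<open>e + 2\<close> and thus no more than the order of the unit steps that follow:
    \<open>r\<close> is small enough for the norm of a block vector and still large enough for the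
    singular values.\<close>
  have "(1 / r)\<^sup>2 = real (e + 2)"
    using r_sq r_pos by (simp add: field_simps)
  then have s: "(\<Sum>k<Suc i. (s k)\<^sup>2) \<le> 2 * real (e + 2)" if "i \<le> e" for i
    using that unfolding sum.lessThan_Suc_shift by (simp add: s_def)
  have bound: "(l $ (i * d + j))\<^sup>2 \<le> 2 * real (e + 2) * W j" if "j < d" "i < e + 1" for i j
  proof -
    have "(l $ (i * d + j))\<^sup>2 \<le> (\<Sum>k<Suc i. (s k)\<^sup>2) * (\<Sum>k<Suc i. (w $ (k * d + j))\<^sup>2)"
      unfolding tele[OF that(1) less_Suc_eq_le[THEN iffD1, OF that(2)[unfolded Suc_eq_plus1[symmetric]]]]
      by (rule sum_mult_squared_le)
    also have "\<dots> \<le> 2 * real (e + 2) * W j"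
      unfolding W_def using s[of i] that by (intro mult_mono sum_mono2) (auto intro!: add_nonneg_nonneg sum_nonneg)
    finally show ?thesis .
  qed
  have W0: "0 \<le> W j" for j unfolding W_def by (intro sum_nonneg) auto
  have "(vnorm l)\<^sup>2 = (\<Sum>j<d. \<Sum>i<e + 1. (l $ (i * d + j))\<^sup>2)"
    using l sum_blocks[of "\<lambda>c. (l $ c)\<^sup>2" "e + 1" d] by (simp add: vnorm_squared_sum p_def)
  also have "\<dots> \<le> (\<Sum>j<d. \<Sum>i<e + 1. 2 * real (e + 2) * W j)"
    using bound by (intro sum_mono) auto
  also have "\<dots> = (\<Sum>j<d. real (e + 1) * (2 * real (e + 2) * W j))"
    by simp
  also have "\<dots> \<le> (\<Sum>j<d. real (e + 2) * (2 * real (e + 2) * W j))"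
    using W0 by (intro sum_mono mult_right_mono) auto
  also have "\<dots> = 2 * (real (e + 2))\<^sup>2 * (\<Sum>j<d. W j)"
    unfolding sum_distrib_left by (intro sum.cong refl) (simp add: power2_eq_square)
  also have "(\<Sum>j<d. W j) = (vnorm w)\<^sup>2"
    using l sum_blocks[of "\<lambda>c. (w $ c)\<^sup>2" "e + 2" d]
    by (simp add: vnorm_squared_sum W_def n_def w_def)
  also have "2 * (real (e + 2))\<^sup>2 * (vnorm w)\<^sup>2 = (sqrt 2 * real (e + 2) * vnorm w)\<^sup>2"
    by (simp add: power_mult_distrib)
  finally show ?thesis
    unfolding w_def by (rule power2_le_imp_le) (simp add: vnorm_nonneg)
qed

text \<open>Needed for small \<open>\<kappa>A\<close>, where only a condition number of exactly the
  ideal size 1 is safe.\<close>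

lemma vnorm_At_two_layers:
  assumes l: "l \<in> carrier_vec p" and e: "e = 0"
  shows "vnorm (transpose_mat A *\<^sub>v l) = vnorm l"
proof -
  have pd: "p = d" unfolding p_eq using e by simp
  have "e * d \<le> c" for c using e by simp
  then have coef: "c < p \<Longrightarrow> coef_l c = r" "coef_r c = r" for c
    by (simp_all add: coef_l_def coef_r_def pd)
  have r2: "2 * r\<^sup>2 = 1" using r_sq e by simp
  have "(vnorm (transpose_mat A *\<^sub>v l))\<^sup>2 = (\<Sum>c<p + d. (if c < p then r\<^sup>2 * (l $ c)\<^sup>2 else 0) +
      (if d \<le> c then r\<^sup>2 * (l $ (c - d))\<^sup>2 else 0))"
    unfolding vnorm_squared_sum n_eq[symmetric] using l pd
    by (intro sum.cong)
      (auto simp: At_mult_index coef dims power_mult_distrib simp del: index_mult_mat_vec)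
  also have "\<dots> = (\<Sum>c<p. r\<^sup>2 * (l $ c)\<^sup>2) + (\<Sum>c<p. r\<^sup>2 * (l $ c)\<^sup>2)"
    unfolding sum.distrib sum_if_less sum_if_ge[where f = "\<lambda>c. r\<^sup>2 * (l $ c)\<^sup>2"] ..
  also have "\<dots> = 2 * r\<^sup>2 * (vnorm l)\<^sup>2"
    using l by (simp add: vnorm_squared_sum sum_distrib_left mult.assoc)
  finally have "(vnorm (transpose_mat A *\<^sub>v l))\<^sup>2 = (vnorm l)\<^sup>2" using r2 by simp
  then show ?thesis by (simp add: vnorm_nonneg)
qed

lemma min_singular_value_A: "0 < min_singular_value A"
  and cond_number_A: "cond_number A \<le> 2 * sqrt 2 * real (e + 2)"
proof -
  define k where "k = sqrt 2 * real (e + 2)"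
  have k: "0 < k" by (simp add: k_def)
  have "1 / k * vnorm l \<le> vnorm (transpose_mat A *\<^sub>v l)" if "l \<in> carrier_vec p" for l
    using vnorm_le_At[OF that] k unfolding k_def[symmetric] by (simp add: pos_divide_le_eq mult.commute)
  from cond_number_le[OF carriers(2) dims(1,3) _ _ this vnorm_At_le]
  show "0 < min_singular_value A" "cond_number A \<le> 2 * sqrt 2 * real (e + 2)"
    using k by (simp_all add: k_def)
qed

lemma cond_number_A_two_layers:
  assumes "e = 0"
  shows "cond_number A \<le> 1"
  using cond_number_le(2)[OF carriers(2) dims(1,3), of 1 1] vnorm_At_two_layers[OF _ assms] by simp

section \<open>Norm of the solution and membership in the problem class\<close>

lemma sum_geometric_squares:
  assumes "t \<le> d"
  shows "(\<Sum>j\<in>{t..<d}. (Y * q ^ j)\<^sup>2) = Y\<^sup>2 * (q ^ (2 * t) - q ^ (2 * d)) / (1 - q\<^sup>2)"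
proof -
  define Q where "Q = q\<^sup>2"
  have Q: "Q \<noteq> 1"
    using q_pos q_less_1 power2_eq_1_iff[of q] by (auto simp: Q_def)
  have "(1 - Q) * (\<Sum>j\<in>{t..<d}. Q ^ j) = Q ^ t - Q ^ d"
    using assms
  proof (induction rule: dec_induct)
    case (step k)
    then show ?case unfolding sum.atLeastLessThan_Suc[OF step(1)] distrib_left step.IH
      by (simp add: algebra_simps)
  qed simp
  then have "(\<Sum>j\<in>{t..<d}. Q ^ j) = (Q ^ t - Q ^ d) / (1 - Q)"
    using Q by (simp add: field_simps)
  moreover have "(Y * q ^ j)\<^sup>2 = Y\<^sup>2 * Q ^ j" for j
    by (simp add: Q_def power_mult_distrib mult.commute flip: power_mult)
  ultimately show ?thesis
    by (simp add: Q_def flip: sum_distrib_left power_mult)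
qed

text \<open>Block \<open>j\<close> contributes \<open>2 + e * r^2\<close>, which is at most 3, times
  the square of \<open>Y * q ^ j\<close>; the geometric sum is bounded by its infinite
  series.\<close>

lemma vnorm_xs_squared_le: "(vnorm xs)\<^sup>2 \<le> 3 * Y\<^sup>2 / (1 - q\<^sup>2)"
proof -
  define v where "v c = (if d \<le> c \<and> c < p then r else 1)" for c
  have v2: "(\<Sum>i<e + 2. (v (i * d + j))\<^sup>2) \<le> 3" if "j < d" for j
  proof -
    have "v j = 1" "v (p + j) = 1" using that by (auto simp: v_def)
    moreover have "v (Suc i * d + j) = r" if "i < e" for i
    proof -
      have "Suc i * d + j < Suc (Suc i) * d" using \<open>j < d\<close> by simp
      also have "\<dots> \<le> p" unfolding p_def using that by (intro mult_le_mono1) simp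
      finally show ?thesis by (simp add: v_def)
    qed
    ultimately have "(\<Sum>i<Suc (Suc e). (v (i * d + j))\<^sup>2) = 2 + real e * r\<^sup>2"
      unfolding sum.lessThan_Suc[of _ "Suc e"] sum.lessThan_Suc_shift[of _ e]
      by (simp add: p_eq add.commute[of d])
    moreover have "real e * r\<^sup>2 + 2 * r\<^sup>2 = 1" using r_sq by (simp add: algebra_simps)
    then have "2 + real e * r\<^sup>2 \<le> 3" using zero_le_power2[of r] by linarith
    ultimately show ?thesis by simp
  qed
  have "(vnorm xs)\<^sup>2 = (\<Sum>c<n. (v c * (Y * q ^ (c mod d)))\<^sup>2)"
    unfolding vnorm_squared_sum by (intro sum.cong) (auto simp: xs_def v_def)
  also have "\<dots> = (\<Sum>j<d. \<Sum>i<e + 2. (v (i * d + j) * (Y * q ^ j))\<^sup>2)"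
    unfolding n_def sum_blocks by (intro sum.cong) auto
  also have "\<dots> = (\<Sum>j<d. (\<Sum>i<e + 2. (v (i * d + j))\<^sup>2) * (Y * q ^ j)\<^sup>2)"
    by (simp only: power_mult_distrib sum_distrib_right)
  also have "\<dots> \<le> (\<Sum>j<d. 3 * (Y * q ^ j)\<^sup>2)"
    using v2 by (intro sum_mono mult_right_mono) auto
  also have "\<dots> = 3 * (Y\<^sup>2 * (1 - q ^ (2 * d)) / (1 - q\<^sup>2))"
    using sum_geometric_squares[of 0] by (simp add: lessThan_atLeast0 flip: sum_distrib_left)
  also have "\<dots> \<le> 3 * (Y\<^sup>2 * 1 / (1 - q\<^sup>2))"
    using q_pos q_less_1 by (intro mult_left_mono divide_right_mono) (auto simp: power_le_one)
  finally show ?thesis by simp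
qed

lemma prob_in_F_SC:
  assumes "cond_number A \<le> \<kappa>" "3 * Y\<^sup>2 / (1 - q\<^sup>2) \<le> D\<^sup>2" "0 < D"
  shows "prob \<in> F_SC (\<mu> + 2 * K) \<mu> \<kappa> D"
proof -
  have "(vnorm xs)\<^sup>2 \<le> D\<^sup>2" using vnorm_xs_squared_le assms(2) by linarith
  then have "vnorm xs \<le> D" using assms(3) by (auto intro: power2_le_imp_le)
  moreover have "vnorm (0\<^sub>v n - xs) = vnorm xs"
  proof -
    have "vnorm (0\<^sub>v n - xs) = vnorm (xs - 0\<^sub>v n)"
      by (rule vnorm_minus_commute[of _ n]) auto
    also have "xs - 0\<^sub>v n = xs" by (intro eq_vecI) auto
    finally show ?thesis .
  qed
  moreover have "smooth_fun n (\<mu> + 2 * K) (quad_fun H b)"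
    using mu_pos K_pos by (intro smooth_fun_quad_fun transpose_H H_upper) auto
  moreover have "strongly_convex_fun n \<mu> (quad_fun H b)"
    by (intro strongly_convex_fun_quad_fun transpose_H H_lower) auto
  ultimately show ?thesis
    using dims assms(1) min_singular_value_A optimal_solution_xs
      proper_fun_indicator_zero convex_fun_indicator_zero closed_fun_indicator_zero
    unfolding F_SC_def by (auto simp: prob_def)
qed

section \<open>Progress of span algorithms along the chain\<close>

text \<open>
  Position of a coordinate along the chain that runs through the blocks one after the other. A row
  of \<open>A\<close> gets the position of its left coordinate, so the same formula serves the dual vectors.
\<close>

definition pos :: "nat \<Rightarrow> nat" where
  "pos c = (c mod d) * (e + 2) + c div d"

definition prefix_space :: "nat \<Rightarrow> nat \<Rightarrow> real vec set" where
  "prefix_space N k = {x \<in> carrier_vec N. \<forall>c<N. k \<le> pos c \<longrightarrow> x $ c = 0}"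

lemma pos_add_d: "pos (c + d) = Suc (pos c)"
  using d_pos by (simp add: pos_def)

lemma mod_last_layer: "j < d \<Longrightarrow> (p + j) mod d = j"
  by (simp only: p_def mod_mult_self3 mod_less)

lemma div_last_layer: "j < d \<Longrightarrow> (p + j) div d = e + 1"
  using d_pos by (simp add: p_def div_mult_self3 del: mult_Suc add_mult_distrib)

lemma pos_last_layer: "j < d \<Longrightarrow> pos (p + j) = j * (e + 2) + e + 1"
  by (simp add: pos_def mod_last_layer div_last_layer)

lemma pos_first_layer: "j < d \<Longrightarrow> pos j = j * (e + 2)"
  by (simp add: pos_def)

text \<open>The end of block \<open>j\<close> and the start of block \<open>j + 1\<close> have the
  consecutive positions \<open>j * (e + 2) + e + 1\<close> and \<open>(j + 1) * (e + 2)\<close>;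
  every other coordinate is its own partner.\<close>

lemma pos_le_partner:
  assumes "c < n"
  shows "pos c \<le> Suc (pos (partner c))"
proof -
  consider (last) "p \<le> c" "Suc c < n" | (first) "0 < c" "c < d"
    | (fixed) "\<not> (p \<le> c \<and> Suc c < n)" "\<not> (0 < c \<and> c < d)" by blast
  then show ?thesis
  proof cases
    case last
    then obtain j where "c = p + j" using le_Suc_ex by blast
    with last show ?thesis
      using n_eq by (simp add: partner_def pos_last_layer pos_first_layer)
  next
    case first
    then obtain j where "c = Suc j" by (cases c) auto
    moreover from this have "partner c = p + j" using first dims by (simp add: partner_def)
    ultimately show ?thesis
      using first pos_last_layer[of j] pos_first_layer[of c] by simp
  next
    case fixed
    then have "partner c = c" by (simp only: partner_def if_False)
    then show ?thesis by simp
  qed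
qed

lemma prefix_space_mono: "k \<le> k' \<Longrightarrow> prefix_space N k \<subseteq> prefix_space N k'"
  by (auto simp: prefix_space_def)

lemma prefix_space_carrier: "prefix_space N k \<subseteq> carrier_vec N"
  by (auto simp: prefix_space_def)

lemma zero_in_prefix_space: "0\<^sub>v N \<in> prefix_space N k"
  by (auto simp: prefix_space_def)

lemma prefix_space_add:
  "u \<in> prefix_space N k \<Longrightarrow> v \<in> prefix_space N k \<Longrightarrow> u + v \<in> prefix_space N k"
  by (auto simp: prefix_space_def)

lemma prefix_space_smult: "v \<in> prefix_space N k \<Longrightarrow> a \<cdot>\<^sub>v v \<in> prefix_space N k"
  by (auto simp: prefix_space_def)

lemma vspan_prefix_space: "S \<subseteq> prefix_space N k \<Longrightarrow> vspan N S \<subseteq> prefix_space N k"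
  by (rule vspan_subset)
    (auto intro: prefix_space_add prefix_space_smult zero_in_prefix_space
      simp: prefix_space_carrier)

text \<open>Row \<open>i\<close> reads the positions \<open>pos i\<close> and
  \<open>pos i + 1\<close>, so passing to the dual side gains nothing. The single step is gained on
  the way back, by the transpose.\<close>

lemma A_prefix_space:
  assumes "x \<in> prefix_space n k"
  shows "A *\<^sub>v x \<in> prefix_space p k"
  using assms n_eq
  by (auto simp: prefix_space_def A_mult_index pos_add_d simp del: index_mult_mat_vec
    intro!: mult_mat_vec_carrier[of _ p n])

lemma At_prefix_space:
  assumes l: "l \<in> prefix_space p k"
  shows "transpose_mat A *\<^sub>v l \<in> prefix_space n (Suc k)"
proof -
  have lc: "l \<in> carrier_vec p" using l prefix_space_carrier by auto
  have "(transpose_mat A *\<^sub>v l) $ c = 0" if c: "c < n" "Suc k \<le> pos c" for c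
  proof -
    have "d \<le> c \<Longrightarrow> k \<le> pos (c - d)" using c pos_add_d[of "c - d"] by simp
    then show ?thesis
      unfolding At_mult_index[OF lc c(1)] using l c n_eq by (auto simp: prefix_space_def)
  qed
  then show ?thesis using lc by (auto simp: prefix_space_def intro!: mult_mat_vec_carrier[of _ n p])
qed

lemma gradient_prefix_space:
  assumes x: "x \<in> prefix_space n k"
  shows "grad n (quad_fun H b) x \<in> prefix_space n (Suc k)"
proof -
  have xc: "x \<in> carrier_vec n" using x prefix_space_carrier by auto
  have "(H *\<^sub>v x - b) $ c = 0" if c: "c < n" "Suc k \<le> pos c" for c
  proof -
    have "k \<le> pos (partner c)" using c pos_le_partner[OF c(1)] by simp
    moreover have "c \<noteq> 0" using c(2) by (cases "c = 0") (auto simp: pos_def)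
    ultimately show ?thesis
      using x xc c partner_less[OF c(1)]
      by (simp add: H_mult_index b_def prefix_space_def del: index_mult_mat_vec)
  qed
  moreover have "grad n (quad_fun H b) x = H *\<^sub>v x - b"
    using mu_pos K_pos xc by (intro grad_quad_fun[where L = "\<mu> + 2 * K"] transpose_H H_upper) auto
  moreover have "H *\<^sub>v x - b \<in> carrier_vec n"
    using xc by (intro minus_carrier_vec mult_mat_vec_carrier[of _ n n]) auto
  ultimately show ?thesis by (simp add: prefix_space_def del: index_mult_mat_vec index_minus_vec)
qed

lemma prob_simps [simp]:
  "obj prob = quad_fun H b" "reg prob = indicator_zero p" "cmat prob = A" "rhs prob = 0\<^sub>v p"
  by (simp_all add: prob_def)

text \<open>Primal and dual spans are controlled together by the same bound. The induction is strong
  because each span draws on all earlier ones.\<close>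

lemma primal_dual_span_run_prefix:
  assumes "primal_dual_span_run prob x l"
  shows "x k \<in> prefix_space n k"
proof -
  obtain \<eta> Sx Sl where
    x0: "x 0 = 0\<^sub>v n" and l0: "l 0 = 0\<^sub>v p"
    and S0: "Sx 0 = vspan n {x 0}" "Sl 0 = vspan p {l 0}"
    and Sx: "\<And>k. Sx (Suc k) = vspan n ({x i | i. i \<le> k} \<union>
        {grad n (quad_fun H b) xh | xh i. i \<le> k \<and> xh \<in> Sx i} \<union>
        {transpose_mat A *\<^sub>v lh | lh i. i \<le> k \<and> lh \<in> Sl i})"
    and Sl: "\<And>k. Sl (Suc k) = vspan p ({l i | i. i \<le> k} \<union>
        {prox p (\<eta> i) (conjugate_fun p (indicator_zero p)) (lh + \<eta> i \<cdot>\<^sub>v (A *\<^sub>v xh - 0\<^sub>v p))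
          | xh lh i. i \<le> k \<and> xh \<in> Sx i \<and> lh \<in> Sl i})"
    and run: "\<And>k. x k \<in> Sx k \<and> l k \<in> Sl k"
    using assms unfolding primal_dual_span_run_def by auto
  have "Sx k \<subseteq> prefix_space n k \<and> Sl k \<subseteq> prefix_space p k" for k
  proof (induction k rule: less_induct)
    case (less k)
    show ?case
    proof (cases k)
      case 0
      then show ?thesis
        using S0 x0 l0 vspan_prefix_space[of "{0\<^sub>v n}" n 0] vspan_prefix_space[of "{0\<^sub>v p}" p 0]
        by (simp add: zero_in_prefix_space)
    next
      case (Suc k')
      have IHx: "u \<in> prefix_space n i" if "u \<in> Sx i" "i \<le> k'" for u i
        using less[of i] that Suc by auto
      have IHl: "u \<in> prefix_space p i" if "u \<in> Sl i" "i \<le> k'" for u i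
        using less[of i] that Suc by auto
      have up: "u \<in> prefix_space N k" if "u \<in> prefix_space N i" "i \<le> Suc k'" for u i N
        using prefix_space_mono[of i k N] that Suc by auto
      have "{x i | i. i \<le> k'} \<subseteq> prefix_space n k"
        using up[OF IHx[OF run[THEN conjunct1]]] by auto
      moreover have "{grad n (quad_fun H b) xh | xh i. i \<le> k' \<and> xh \<in> Sx i} \<subseteq> prefix_space n k"
        using up[OF gradient_prefix_space[OF IHx]] by auto
      moreover have "{transpose_mat A *\<^sub>v lh | lh i. i \<le> k' \<and> lh \<in> Sl i} \<subseteq> prefix_space n k"
        by (auto intro!: up[OF At_prefix_space] IHl)
      ultimately have "Sx k \<subseteq> prefix_space n k"
        unfolding Suc Sx by (intro vspan_prefix_space) (simp add: Suc)
      moreover have "{l i | i. i \<le> k'} \<subseteq> prefix_space p k"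
        using up[OF IHl[OF run[THEN conjunct2]]] by auto
      moreover have "prox p (\<eta> i) (conjugate_fun p (indicator_zero p)) (lh + \<eta> i \<cdot>\<^sub>v (A *\<^sub>v xh - 0\<^sub>v p))
          \<in> prefix_space p k" if "i \<le> k'" "xh \<in> Sx i" "lh \<in> Sl i" for xh lh i
      proof -
        have "A *\<^sub>v xh \<in> prefix_space p i"
          by (rule A_prefix_space[OF IHx[OF that(2,1)]])
        moreover from this have "A *\<^sub>v xh - 0\<^sub>v p = A *\<^sub>v xh"
          using prefix_space_carrier by auto
        ultimately have "lh + \<eta> i \<cdot>\<^sub>v (A *\<^sub>v xh - 0\<^sub>v p) \<in> prefix_space p i"
          using IHl[OF that(3,1)] by (simp add: prefix_space_add prefix_space_smult)
        moreover from this have "lh + \<eta> i \<cdot>\<^sub>v (A *\<^sub>v xh - 0\<^sub>v p) \<in> carrier_vec p"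
          using prefix_space_carrier by blast
        ultimately show ?thesis
          using up that(1) by (simp add: prox_conjugate_indicator_zero)
      qed
      then have "{prox p (\<eta> i) (conjugate_fun p (indicator_zero p)) (lh + \<eta> i \<cdot>\<^sub>v (A *\<^sub>v xh - 0\<^sub>v p))
          | xh lh i. i \<le> k' \<and> xh \<in> Sx i \<and> lh \<in> Sl i} \<subseteq> prefix_space p k"
        by blast
      ultimately show ?thesis
        unfolding Suc Sl by (intro conjI vspan_prefix_space) (simp_all add: Suc)
    qed
  qed
  then show ?thesis using run by blast
qed

lemma equality_span_run_prefix:
  assumes "equality_span_run prob x"
  shows "x k \<in> prefix_space n k"
proof -
  obtain Sx where x0: "x 0 = 0\<^sub>v n" and S0: "Sx 0 = vspan n {x 0}"
    and Sx: "\<And>k. Sx (Suc k) = vspan n ({x i | i. i \<le> k} \<union>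
        {grad n (quad_fun H b) xh | xh i. i \<le> k \<and> xh \<in> Sx i} \<union>
        {transpose_mat A *\<^sub>v (A *\<^sub>v xh - 0\<^sub>v p) | xh i. i \<le> k \<and> xh \<in> Sx i})"
    and run: "\<And>k. x k \<in> Sx k"
    using assms unfolding equality_span_run_def by auto
  have "Sx k \<subseteq> prefix_space n k" for k
  proof (induction k rule: less_induct)
    case (less k)
    show ?case
    proof (cases k)
      case 0
      then show ?thesis
        using S0 x0 vspan_prefix_space[of "{0\<^sub>v n}" n 0] by (simp add: zero_in_prefix_space)
    next
      case (Suc k')
      have IH: "u \<in> prefix_space n i" if "u \<in> Sx i" "i \<le> k'" for u i
        using less[of i] that Suc by auto
      have up: "u \<in> prefix_space n k" if "u \<in> prefix_space n i" "i \<le> Suc k'" for u i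
        using prefix_space_mono[of i k n] that Suc by auto
      have "{x i | i. i \<le> k'} \<subseteq> prefix_space n k"
        using up[OF IH[OF run]] by auto
      moreover have "{grad n (quad_fun H b) xh | xh i. i \<le> k' \<and> xh \<in> Sx i} \<subseteq> prefix_space n k"
        using up[OF gradient_prefix_space[OF IH]] by auto
      moreover have "transpose_mat A *\<^sub>v (A *\<^sub>v xh - 0\<^sub>v p) \<in> prefix_space n k"
        if "i \<le> k'" "xh \<in> Sx i" for xh i
      proof -
        have *: "A *\<^sub>v xh \<in> prefix_space p i" by (rule A_prefix_space[OF IH[OF that(2,1)]])
        then have "A *\<^sub>v xh - 0\<^sub>v p = A *\<^sub>v xh" using prefix_space_carrier by auto
        then show ?thesis using up[OF At_prefix_space[OF *]] that(1) by simp
      qed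
      then have "{transpose_mat A *\<^sub>v (A *\<^sub>v xh - 0\<^sub>v p) | xh i. i \<le> k' \<and> xh \<in> Sx i} \<subseteq> prefix_space n k"
        by blast
      ultimately show ?thesis
        unfolding Suc Sx by (intro vspan_prefix_space) (simp add: Suc)
    qed
  qed
  then show ?thesis using run by blast
qed

text \<open>Only the last coordinate of each block is counted: a block contributes to the bound as
  long as its end has not been reached.\<close>

lemma vnorm_error_ge:
  assumes x: "x \<in> prefix_space n k" and t: "t = k div (e + 2)" "t \<le> d"
  shows "Y\<^sup>2 * (q ^ (2 * t) - q ^ (2 * d)) / (1 - q\<^sup>2) \<le> (vnorm (x - xs))\<^sup>2"
proof -
  have xc: "x \<in> carrier_vec n" using x prefix_space_carrier by auto
  have val: "((x - xs) $ (p + j))\<^sup>2 = (Y * q ^ j)\<^sup>2" if j: "j \<in> {t..<d}" for j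
  proof -
    \<comment> \<open>Block \<open>t\<close> may be partly explored, but its last position
      \<open>Suc t * (e + 2) - 1\<close> is still at least \<open>k\<close>; hence the sum may start
      at \<open>t\<close> itself.\<close>
    have "k < Suc t * (e + 2)"
      unfolding t(1) using dividend_less_div_times[of "e + 2" k] by simp
    also have "\<dots> \<le> Suc j * (e + 2)" using j by (intro mult_le_mono1) simp
    finally have "k \<le> pos (p + j)" using j by (simp add: pos_last_layer)
    moreover have "p + j < n" using j n_eq by simp
    ultimately have "x $ (p + j) = 0" using x by (auto simp: prefix_space_def)
    moreover have "(p + j) mod d = j" using j by (simp add: mod_last_layer)
    ultimately show ?thesis
      using xc j n_eq by (simp add: xs_def)
  qed
  have "Y\<^sup>2 * (q ^ (2 * t) - q ^ (2 * d)) / (1 - q\<^sup>2) = (\<Sum>j\<in>{t..<d}. ((x - xs) $ (p + j))\<^sup>2)"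
    unfolding sum_geometric_squares[OF t(2), symmetric] using val by (intro sum.cong) auto
  also have "\<dots> = (\<Sum>c\<in>(+) p ` {t..<d}. ((x - xs) $ c)\<^sup>2)"
    by (subst sum.reindex) auto
  also have "\<dots> \<le> (\<Sum>c<n. ((x - xs) $ c)\<^sup>2)"
    using n_eq by (intro sum_mono2) auto
  also have "\<dots> = (vnorm (x - xs))\<^sup>2" using xc by (simp add: vnorm_squared_sum)
  finally show ?thesis .
qed

end

section \<open>Decay rate, constants and the final bound\<close>

text \<open>With \<open>q = \<rho>^2\<close> the equation becomes
  \<open>1 / \<rho> - \<rho> = sqrt \<delta>\<close>, a quadratic in \<rho>. The logarithm is then
  bounded through \<open>ln y \<le> y - 1\<close> at
  \<open>y = 1 / \<rho> = \<rho> + sqrt \<delta>\<close>.\<close>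

lemma decay_rate_exists:
  assumes "0 < \<delta>"
  obtains q :: real where "0 < q" "q < 1" "q + 1 / q - 2 = \<delta>" "ln (1 / q) \<le> 2 * sqrt \<delta>"
proof -
  define s where "s = sqrt \<delta>"
  define \<rho> where "\<rho> = (sqrt (s\<^sup>2 + 4) - s) / 2"
  have s: "0 < s" "s\<^sup>2 = \<delta>" using assms by (auto simp: s_def)
  have "s < sqrt (s\<^sup>2 + 4)" by (rule real_less_rsqrt) simp
  then have \<rho>: "0 < \<rho>" using s by (simp add: \<rho>_def)
  have "(sqrt (s\<^sup>2 + 4))\<^sup>2 = s\<^sup>2 + 4" by simp
  then have prod: "\<rho> * (\<rho> + s) = 1"
    unfolding \<rho>_def by (simp add: field_simps power2_eq_square)
  have \<rho>1: "\<rho> < 1"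
  proof (rule ccontr)
    assume "\<not> \<rho> < 1"
    then have "1 * 1 < \<rho> * (\<rho> + s)" using s by (intro mult_le_less_imp_less) auto
    then show False using prod by simp
  qed
  have inv: "1 / \<rho> = \<rho> + s" using prod \<rho> by (simp add: field_simps)
  show ?thesis
  proof
    show "0 < \<rho>\<^sup>2" using \<rho> by simp
    show "\<rho>\<^sup>2 < 1" using \<rho> \<rho>1 by (simp add: power_less_one_iff)
    have "\<rho>\<^sup>2 + 1 / \<rho>\<^sup>2 - 2 = (1 / \<rho> - \<rho>)\<^sup>2"
      using \<rho> by (simp add: field_simps power2_eq_square)
    also have "\<dots> = \<delta>" unfolding inv using s by simp
    finally show "\<rho>\<^sup>2 + 1 / \<rho>\<^sup>2 - 2 = \<delta>" .
    have "ln (1 / \<rho>\<^sup>2) = 2 * ln (\<rho> + s)"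
      using \<rho> by (simp add: ln_realpow flip: inv power_one_over)
    also have "\<dots> \<le> 2 * s"
      using ln_le_minus_one[of "\<rho> + s"] \<rho> \<rho>1 s by simp
    finally show "ln (1 / \<rho>\<^sup>2) \<le> 2 * sqrt \<delta>" by (simp add: s_def)
  qed
qed

text \<open>Too small an error would need \<open>t * ln (1 / q)\<close> to be at least
  \<open>2 / 3 * l\<close>, where \<open>t\<close> counts the blocks passed and \<open>l\<close> is
  \<open>ln (D / \<epsilon>)\<close>; the bound on \<open>k\<close> allows only
  \<open>42 / 100 * l\<close>.\<close>

lemma error_exceeds_tolerance:
  fixes q \<kappa>f \<kappa>A D \<epsilon> \<delta> :: real and k m :: nat
  assumes q: "0 < q" "ln (1 / q) \<le> 2 * sqrt \<delta>" and \<delta>: "0 < \<delta>" "\<delta> \<le> 12 / \<kappa>f" and \<kappa>f: "0 < \<kappa>f"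
    and m: "0 < m" "\<kappa>A \<le> 6 * real m" and \<epsilon>: "0 < \<epsilon>" "\<epsilon> \<le> D / 20"
    and k: "real k < 1 / 100 * (\<kappa>A * sqrt \<kappa>f * ln (D / \<epsilon>))"
  shows "\<epsilon>\<^sup>2 < D\<^sup>2 * q ^ (2 * (k div m)) / 6"
proof (rule ccontr)
  define t where "t = k div m"
  define l where "l = ln (D / \<epsilon>)"
  assume "\<not> ?thesis"
  then have le: "(D / \<epsilon>)\<^sup>2 * q ^ (2 * t) \<le> 6"
    using \<epsilon> by (simp add: t_def field_simps)
  have D: "0 < D" "20 \<le> D / \<epsilon>" using \<epsilon> by (auto simp: field_simps)
  have l20: "ln 20 \<le> l" unfolding l_def using D by (intro ln_mono) auto
  then have l: "0 < l" using ln_gt_zero[of "20 :: real"] by linarith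
  \<comment> \<open>As 216 is at most 400, \<open>ln 6\<close> is at most two thirds of
    \<open>ln 20\<close>, hence of \<open>l\<close>.\<close>
  have "ln ((6 :: real) ^ 3) \<le> ln (20 ^ 2)" by (intro ln_mono) auto
  then have ln6: "3 * ln 6 \<le> 2 * ln (20 :: real)" by (simp only: ln_realpow)
  have "2 * l - 2 * real t * ln (1 / q) = ln ((D / \<epsilon>)\<^sup>2 * q ^ (2 * t))"
    using D q \<epsilon> by (simp add: ln_mult ln_realpow ln_div l_def)
  also have "\<dots> \<le> ln 6" using le D q \<epsilon> by (intro ln_mono) auto
  finally have main: "2 * l \<le> ln 6 + 2 * (real t * ln (1 / q))" by simp
  have "sqrt \<delta> \<le> sqrt (12 / \<kappa>f)" using \<delta> by simp
  also have "\<dots> = sqrt 12 / sqrt \<kappa>f" by (rule real_sqrt_divide)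
  also have "\<dots> \<le> 3.5 / sqrt \<kappa>f"
    using \<kappa>f by (intro divide_right_mono real_le_lsqrt) (auto simp: power2_eq_square)
  finally have lnq: "ln (1 / q) \<le> 7 / sqrt \<kappa>f" using q by simp
  have "real t * real m \<le> real k"
    unfolding t_def by (metis div_times_less_eq_dividend of_nat_le_iff of_nat_mult)
  also have "\<dots> \<le> 1 / 100 * (\<kappa>A * sqrt \<kappa>f * l)" using k by (simp add: l_def)
  also have "\<dots> \<le> 1 / 100 * (6 * real m * sqrt \<kappa>f * l)"
    using m \<kappa>f l by (intro mult_left_mono mult_right_mono) auto
  finally have "real m * real t \<le> real m * (6 / 100 * (sqrt \<kappa>f * l))" by (simp add: mult_ac)
  then have t: "real t \<le> 6 / 100 * (sqrt \<kappa>f * l)" using m by (simp only: mult_le_cancel_left_pos of_nat_0_less_iff)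
  have "real t * ln (1 / q) \<le> real t * (7 / sqrt \<kappa>f)"
    using lnq by (intro mult_left_mono) auto
  also have "\<dots> \<le> 6 / 100 * (sqrt \<kappa>f * l) * (7 / sqrt \<kappa>f)"
    using t \<kappa>f by (intro mult_right_mono) auto
  also have "\<dots> = 42 / 100 * l" using \<kappa>f by simp
  finally show False using main ln6 l20 l by linarith
qed

theorem corollary6:
  shows "\<exists>c::real. c > 0 \<and>
    (\<forall>(Lf::real) (\<mu>f::real) (\<kappa>A::real) (D::real) (\<epsilon>::real)
        (alg :: problem \<Rightarrow> nat \<Rightarrow> real vec \<times> real vec).
       0 < \<mu>f \<and> \<mu>f \<le> Lf \<and> 2 \<le> Lf / \<mu>f \<and> 1 \<le> \<kappa>A \<and> 0 < D \<and> 0 < \<epsilon> \<and> \<epsilon> \<le> D / 20 \<and>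
       span_algorithm (F_SC Lf \<mu>f \<kappa>A D) alg \<longrightarrow>
       (\<exists>P\<in>F_SC Lf \<mu>f \<kappa>A D. \<exists>xs. optimal_solution P xs \<and>
          (\<forall>k. vnorm (fst (alg P k) - xs) \<le> \<epsilon> \<longrightarrow>
             c * (\<kappa>A * sqrt (Lf / \<mu>f) * ln (D / \<epsilon>)) \<le> real k)))"
proof (intro exI[of _ "1 / 100"] conjI allI impI; (elim conjE)?)
  fix Lf \<mu> \<kappa>A D \<epsilon> :: real and alg :: "problem \<Rightarrow> nat \<Rightarrow> real vec \<times> real vec"
  assume \<mu>: "0 < \<mu>" and "\<mu> \<le> Lf" and \<kappa>f: "2 \<le> Lf / \<mu>" and \<kappa>A: "1 \<le> \<kappa>A" and D: "0 < D"
    and \<epsilon>: "0 < \<epsilon>" "\<epsilon> \<le> D / 20" and alg: "span_algorithm (F_SC Lf \<mu> \<kappa>A D) alg"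
  \<comment> \<open>Chosen so that the smoothness constant \<open>\<mu> + 2 * K\<close> is exactly
    \<open>Lf\<close>; it is positive because \<open>\<kappa>f\<close> is at least 2.\<close>
  define K where "K = (Lf - \<mu>) / 2"
  have Lf: "2 * \<mu> \<le> Lf" using \<kappa>f \<mu> by (simp add: field_simps)
  have K: "0 < K" "\<mu> + 2 * K = Lf" using Lf \<mu> by (auto simp: K_def field_simps)
  \<comment> \<open>The divisor 3 leaves room for \<open>2 * sqrt 2 \<le> 3\<close> in the condition
    number. From \<open>\<kappa>A = 6\<close> on, the floor is at least 2 and loses at most a factor
    of two, whence \<open>\<kappa>A \<le> 6 * m\<close>.\<close>
  define m where "m = (if \<kappa>A < 6 then 2 else nat \<lfloor>\<kappa>A / 3\<rfloor>)"
  have m2: "2 \<le> m" and m6: "\<kappa>A \<le> 6 * real m" and m3: "6 \<le> \<kappa>A \<Longrightarrow> real m \<le> \<kappa>A / 3"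
    unfolding m_def by (auto simp: le_nat_floor) linarith+
  define e where "e = m - 2"
  have em: "e + 2 = m" using m2 by (simp add: e_def)
  define r where "r = 1 / sqrt (real m)"
  have r: "0 < r" "r\<^sup>2 * real (e + 2) = 1"
    unfolding em using m2 by (auto simp: r_def power_divide)
  define \<delta> where "\<delta> = \<mu> * (2 + real e * r\<^sup>2) / K"
  have "real e * r\<^sup>2 + 2 * r\<^sup>2 = 1" using r(2) by (simp add: algebra_simps)
  then have er: "real e * r\<^sup>2 \<le> 1" using zero_le_power2[of r] by linarith
  have \<delta>0: "0 < \<delta>" using \<mu> K by (auto simp: \<delta>_def intro!: divide_pos_pos mult_pos_pos add_pos_nonneg)
  have "\<delta> \<le> \<mu> * 3 / K"
    unfolding \<delta>_def using \<mu> K er by (intro divide_right_mono mult_left_mono) auto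
  \<comment> \<open>Since \<open>Lf\<close> is at least \<open>2 * \<mu>\<close>, \<open>K\<close>
    is at least \<open>Lf / 4\<close>.\<close>
  also have "\<dots> \<le> 12 / (Lf / \<mu>)" using \<mu> K Lf by (simp add: K_def field_simps)
  finally have \<delta>: "\<delta> \<le> 12 / (Lf / \<mu>)" .
  obtain q where q: "0 < q" "q < 1" "q + 1 / q - 2 = \<delta>" "ln (1 / q) \<le> 2 * sqrt \<delta>"
    using decay_rate_exists[OF \<delta>0] by blast
  \<comment> \<open>Normalised so that the bound \<open>3 * Y^2 / (1 - q^2)\<close> on the squared
    norm of the solution equals \<open>D^2\<close>.\<close>
  define Y where "Y = D * sqrt ((1 - q\<^sup>2) / 3)"
  have q2: "0 < 1 - q\<^sup>2" using q by (simp add: power_less_one_iff)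
  then have Y: "Y\<^sup>2 = D\<^sup>2 * (1 - q\<^sup>2) / 3" by (simp add: Y_def power_mult_distrib)
  obtain n0 where n0: "(q\<^sup>2) ^ n0 < 1 / 2"
    using real_arch_pow_inv[of "1 / 2" "q\<^sup>2"] q2 by auto
  define B where "B = 1 / 100 * (\<kappa>A * sqrt (Lf / \<mu>) * ln (D / \<epsilon>))"
  \<comment> \<open>Fewer than \<open>B\<close> iterations pass at most
    \<open>nat \<lceil>B\<rceil>\<close> blocks; the additional \<open>n0\<close> blocks shrink the
    squared tail below half of the leading term.\<close>
  define d where "d = Suc (nat \<lceil>B\<rceil> + n0)"
  interpret chain e d r \<mu> K q Y
    using r \<mu> K q by unfold_locales (auto simp: d_def \<delta>_def)
  have cond: "cond_number A \<le> \<kappa>A"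
  proof (cases "\<kappa>A < 6")
    case True
    then have "cond_number A \<le> 1" by (intro cond_number_A_two_layers) (simp add: e_def m_def)
    then show ?thesis using \<kappa>A by simp
  next
    case False
    have "sqrt 2 \<le> (3 / 2 :: real)" by (intro real_le_lsqrt) (auto simp: power2_eq_square)
    then have "2 * sqrt 2 * real m \<le> 3 * (\<kappa>A / 3)"
      using m3 False by (intro mult_mono) auto
    then show ?thesis using cond_number_A unfolding em by simp
  qed
  have P: "prob \<in> F_SC Lf \<mu> \<kappa>A D"
    using prob_in_F_SC[OF cond _ D] Y q2 unfolding K(2) by simp
  \<comment> \<open>The instance was built from the parameters alone; the algorithm enters only
    here.\<close>
  then have "primal_dual_span_run prob (\<lambda>k. fst (alg prob k)) (\<lambda>k. snd (alg prob k)) \<or>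
      equality_span_run prob (\<lambda>k. fst (alg prob k))"
    using alg unfolding span_algorithm_def by blast
  then have prefix: "fst (alg prob k) \<in> prefix_space n k" for k
    using primal_dual_span_run_prefix equality_span_run_prefix by blast
  have "B \<le> real k" if close: "vnorm (fst (alg prob k) - xs) \<le> \<epsilon>" for k
  proof (rule ccontr)
    assume "\<not> B \<le> real k"
    then have k: "real k < B" by simp
    define t where "t = k div (e + 2)"
    have "k \<le> nat \<lceil>B\<rceil>" using k by linarith
    moreover have "t \<le> k" by (simp add: t_def)
    ultimately have td: "t + n0 \<le> d" by (simp add: d_def)
    have "q ^ (2 * d) \<le> q ^ (2 * (t + n0))"
      using td q by (intro power_decreasing) auto
    also have "\<dots> = q ^ (2 * t) * (q\<^sup>2) ^ n0" by (simp add: power_add flip: power_mult)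
    also have "\<dots> \<le> q ^ (2 * t) * (1 / 2)" using n0 q by (intro mult_left_mono) auto
    finally have half: "q ^ (2 * t) / 2 \<le> q ^ (2 * t) - q ^ (2 * d)" by simp
    have cancel: "u / 3 * v = u * w / 3 * v / w" if "0 < w" for u v w :: real
      using that by simp
    have "D\<^sup>2 * q ^ (2 * t) / 6 = D\<^sup>2 / 3 * (q ^ (2 * t) / 2)" by simp
    also have "\<dots> \<le> D\<^sup>2 / 3 * (q ^ (2 * t) - q ^ (2 * d))"
      using half by (intro mult_left_mono) auto
    also have "\<dots> = Y\<^sup>2 * (q ^ (2 * t) - q ^ (2 * d)) / (1 - q\<^sup>2)"
      unfolding Y by (rule cancel[OF q2])
    also have "\<dots> \<le> (vnorm (fst (alg prob k) - xs))\<^sup>2"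
      using vnorm_error_ge[OF prefix t_def] td by simp
    also have "\<dots> \<le> \<epsilon>\<^sup>2" using close by (intro power_mono) (auto simp: vnorm_nonneg)
    finally have "D\<^sup>2 * q ^ (2 * (k div m)) / 6 \<le> \<epsilon>\<^sup>2" unfolding t_def em .
    moreover have "\<epsilon>\<^sup>2 < D\<^sup>2 * q ^ (2 * (k div m)) / 6"
      using error_exceeds_tolerance[OF q(1,4) \<delta>0 \<delta> _ _ m6 \<epsilon> k[unfolded B_def]] \<kappa>f m2 by simp
    ultimately show False by simp
  qed
  then show "\<exists>P\<in>F_SC Lf \<mu> \<kappa>A D. \<exists>xs. optimal_solution P xs \<and>
      (\<forall>k. vnorm (fst (alg P k) - xs) \<le> \<epsilon> \<longrightarrow>
        1 / 100 * (\<kappa>A * sqrt (Lf / \<mu>) * ln (D / \<epsilon>)) \<le> real k)"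
    using P optimal_solution_xs unfolding B_def by blast
qed simp

end
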